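(* Let $(\alpha,\gamma,\theta)$ be a pre-prolongation of a central extension $\mathcal E_0: 0\to A_0\xrightarrow{j_0}B_0\xrightarrow{p_0}G_0\to 0$, and let $\Pi_0=\operatorname{Coker}\gamma$. Then $\mathcal E_0$ has an $(\alpha,\gamma)$-prolongation if and only if the obstruction $\mathrm{Obs}(\alpha,\gamma,\theta)$ vanishes in $H^3(\Pi_0,A)$.
   Context: Groups are written additively even when non-abelian, except $\Pi_0$, which is written multiplicatively. Setting: $\mathcal E_0: 0\to A_0\xrightarrow{j_0}B_0\xrightarrow{p_0}G_0\to 0$ is a short exact sequence of groups with $j_0A_0$ contained in the center of $B_0$; $\alpha:A_0\to A$ is a surjective group homomorphism; $\gamma:G_0\to G$ is an injective group homomorphism with normal image; $\Pi_0=\operatorname{Coker}\gamma=G/\gamma G_0$ with projection $\sigma:G\to\Pi_0$; $E_0=B_0/j_0(\operatorname{Ker}\alpha)$; $\pi:E_0\to G_0$ is $\pi(b_0+j_0\operatorname{Ker}\alpha)=p_0(b_0)$; $i:A\to E_0$ is $i(\alpha a_0)=j_0a_0+j_0\operatorname{Ker}\alpha$, so $i$ is injective with central image $\operatorname{Ker}\pi$, and $A$ is identified with $i(A)$. Crossed module: a quadruple $(B,D,d,\theta)$ with group homomorphisms $d:B\to D$, $\theta:D\to\operatorname{Aut}B$ such that $\theta_{d(b)}=\mu_b$ and $d(\theta_x(b))=\mu_x(d(b))$ for all $b\in B$, $x\in D$, where $\mu$ denotes conjugation. Pre-prolongation of $\mathcal E_0$: a triple $(\alpha,\gamma,\theta)$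 with $\alpha:A_0\to A$ a surjective group homomorphism, $\gamma:G_0\to G$ an injective group homomorphism with normal image, and $\theta:G\to\operatorname{Aut}E_0$ a group homomorphism such that $(E_0,G,\gamma\pi,\theta)$ is a crossed module. Then $A$ is a $\Pi_0$-module via $xa=i^{-1}\theta_u(ia)$ for any $u\in G$ with $\sigma(u)=x$; the cohomology $H^3(\Pi_0,A)$ is taken with respect to this action. $(\alpha,\gamma)$-prolongation of $\mathcal E_0$: a short exact sequence of groups $\mathcal E: 0\to A\xrightarrow{j}B\xrightarrow{p}G\to 0$ together with a group homomorphism $\beta:B_0\to B$ with $\beta j_0=j\alpha$ and $p\beta=\gamma p_0$. Obstruction: Choose representatives $u_x\in G$ with $\sigma(u_x)=x$ $(x\in\Pi_0)$ and $u_1=0$; put $f(x,y)=u_x+u_y-u_{xy}\in\gamma G_0$ and $\varphi(x)=\theta_{u_x}$. Choose $h:\Pi_0^2\to E_0$ with $\gamma\pi[h(x,y)]=f(x,y)$ and $h(x,1)=h(1,y)=0$. Define $k:\Pi_0^3\to A$ by $$\varphi(x)h(y,z)+h(x,yz)=h(x,y)+h(xy,z)+k(x,y,z).$$ Then $k$ is a 3-cocycle whose class in $H^3(\Pi_0,A)$ does not depend on the choices of $u$ and $h$; set $\mathrm{Obs}(\alpha,\gamma,\theta)=[k]\in H^3(\Pi_0,A)$.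
   Formalization: "Has a prolongation" is read as "has a prolongation whose induced conjugation action of G on E_0 is θ"; without this, a prolongation inducing another action can exist although Obs(α,γ,θ) is nonzero. The middle group B is taken, up to isomorphism, on a set of pairs from A and G. *)

theory Defs
  imports "HOL-Algebra.Algebra"
begin

text \<open>
  All groups are \<open>HOL-Algebra\<close> groups and hence written multiplicatively; the mathematical
  formulas in the comments below are additive where this is customary.
\<close>

section \<open>Group cohomology\<close>

text \<open>
  The standard inhomogeneous complex of a group \<open>P\<close> with coefficients in an abelian group \<open>A\<close>
  (both multiplicative) on which \<open>P\<close> acts through \<open>act\<close>.  An \<open>n\<close>-cochain is a function
  of lists of length \<open>n\<close>.
\<close>

definition tuples :: "'x monoid \<Rightarrow> nat \<Rightarrow> 'x list set" where
  "tuples P n = {xs. length xs = n \<and> set xs \<subseteq> carrier P}"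

definition cochains :: "'x monoid \<Rightarrow> 'a monoid \<Rightarrow> nat \<Rightarrow> ('x list \<Rightarrow> 'a) monoid" where
  "cochains P A n = product_group (tuples P n) (\<lambda>_. A)"

text \<open>
  Additively, \<open>(\<delta>f)(x\<^sub>1,\<dots>,x\<^sub>n\<^sub>+\<^sub>1) = x\<^sub>1 f(x\<^sub>2,\<dots>,x\<^sub>n\<^sub>+\<^sub>1)
    + (\<Sum>i=1..n. (-1)^i f(\<dots>,x\<^sub>i x\<^sub>i\<^sub>+\<^sub>1,\<dots>)) + (-1)^(n+1) f(x\<^sub>1,\<dots>,x\<^sub>n)\<close>;
  below, the index \<open>i\<close> starts at \<open>0\<close>.
\<close>

definition coboundary ::
  "'x monoid \<Rightarrow> 'a monoid \<Rightarrow> ('x \<Rightarrow> 'a \<Rightarrow> 'a) \<Rightarrow> nat \<Rightarrow> ('x list \<Rightarrow> 'a) \<Rightarrow> 'x list \<Rightarrow> 'a" where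
  "coboundary P A act n f = (\<lambda>xs\<in>tuples P (Suc n).
     act (hd xs) (f (tl xs))
     \<otimes>\<^bsub>A\<^esub> (\<Otimes>\<^bsub>A\<^esub>i\<in>{..<n}.
           f (take i xs @ (xs ! i \<otimes>\<^bsub>P\<^esub> xs ! Suc i) # drop (i + 2) xs) [^]\<^bsub>A\<^esub> ((- 1) ^ Suc i :: int))
     \<otimes>\<^bsub>A\<^esub> f (butlast xs) [^]\<^bsub>A\<^esub> ((- 1) ^ Suc n :: int))"

definition cocycles ::
  "'x monoid \<Rightarrow> 'a monoid \<Rightarrow> ('x \<Rightarrow> 'a \<Rightarrow> 'a) \<Rightarrow> nat \<Rightarrow> ('x list \<Rightarrow> 'a) monoid" where
  "cocycles P A act n = (cochains P A n)
     \<lparr>carrier := kernel (cochains P A n) (cochains P A (Suc n)) (coboundary P A act n)\<rparr>"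

fun coboundaries ::
  "'x monoid \<Rightarrow> 'a monoid \<Rightarrow> ('x \<Rightarrow> 'a \<Rightarrow> 'a) \<Rightarrow> nat \<Rightarrow> ('x list \<Rightarrow> 'a) set" where
  "coboundaries P A act 0 = {\<one>\<^bsub>cochains P A 0\<^esub>}"
| "coboundaries P A act (Suc n) = coboundary P A act n ` carrier (cochains P A n)"

definition cohomology ::
  "'x monoid \<Rightarrow> 'a monoid \<Rightarrow> ('x \<Rightarrow> 'a \<Rightarrow> 'a) \<Rightarrow> nat \<Rightarrow> ('x list \<Rightarrow> 'a) set monoid" where
  "cohomology P A act n = cocycles P A act n Mod coboundaries P A act n"

definition cohomology_class ::
  "'x monoid \<Rightarrow> 'a monoid \<Rightarrow> ('x \<Rightarrow> 'a \<Rightarrow> 'a) \<Rightarrow> nat \<Rightarrow> ('x list \<Rightarrow> 'a) \<Rightarrow> ('x list \<Rightarrow> 'a) set" where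
  "cohomology_class P A act n k = coboundaries P A act n #>\<^bsub>cocycles P A act n\<^esub> k"


section \<open>Extensions and crossed modules\<close>

definition short_exact ::
  "'a monoid \<Rightarrow> ('a \<Rightarrow> 'b) \<Rightarrow> 'b monoid \<Rightarrow> ('b \<Rightarrow> 'g) \<Rightarrow> 'g monoid \<Rightarrow> bool" where
  "short_exact A j B p G \<longleftrightarrow>
     group A \<and> group B \<and> group G \<and> j \<in> mon A B \<and> p \<in> epi B G \<and> j ` carrier A = kernel B G p"

definition conj_by :: "'b monoid \<Rightarrow> 'b \<Rightarrow> 'b \<Rightarrow> 'b" where
  "conj_by B b c = b \<otimes>\<^bsub>B\<^esub> c \<otimes>\<^bsub>B\<^esub> inv\<^bsub>B\<^esub> b"

definition crossed_module ::
  "'b monoid \<Rightarrow> 'd monoid \<Rightarrow> ('b \<Rightarrow> 'd) \<Rightarrow> ('d \<Rightarrow> 'b \<Rightarrow> 'b) \<Rightarrow> bool" where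
  "crossed_module B D d \<theta> \<longleftrightarrow>
     group B \<and> group D \<and> d \<in> hom B D \<and> \<theta> \<in> hom D (AutoGroup B) \<and>
     (\<forall>b\<in>carrier B. \<forall>c\<in>carrier B. \<theta> (d b) c = conj_by B b c) \<and>
     (\<forall>x\<in>carrier D. \<forall>b\<in>carrier B. d (\<theta> x b) = conj_by D x (d b))"

locale central_extension =
  fixes A0 :: "'a0 monoid" and j0 :: "'a0 \<Rightarrow> 'b0" and B0 :: "'b0 monoid"
    and p0 :: "'b0 \<Rightarrow> 'g0" and G0 :: "'g0 monoid"
  assumes exact: "short_exact A0 j0 B0 p0 G0"
    and central: "\<And>a b. a \<in> carrier A0 \<Longrightarrow> b \<in> carrier B0 \<Longrightarrow> j0 a \<otimes>\<^bsub>B0\<^esub> b = b \<otimes>\<^bsub>B0\<^esub> j0 a"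

locale prolongation_data = central_extension A0 j0 B0 p0 G0
  for A0 :: "'a0 monoid" and j0 :: "'a0 \<Rightarrow> 'b0" and B0 :: "'b0 monoid"
    and p0 :: "'b0 \<Rightarrow> 'g0" and G0 :: "'g0 monoid" +
  fixes A :: "'a monoid" and \<alpha> :: "'a0 \<Rightarrow> 'a" and G :: "'g monoid" and \<gamma> :: "'g0 \<Rightarrow> 'g"
  assumes group_A: "group A" and group_G: "group G"
    and alpha: "\<alpha> \<in> epi A0 A" and gamma: "\<gamma> \<in> mon G0 G"
    and gamma_normal: "\<gamma> ` carrier G0 \<lhd> G"
begin

definition Pi0 :: "'g set monoid" where
  "Pi0 = G Mod (\<gamma> ` carrier G0)"

definition \<sigma> :: "'g \<Rightarrow> 'g set" where
  "\<sigma> u = (\<gamma> ` carrier G0) #>\<^bsub>G\<^esub> u"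

definition E0 :: "'b0 set monoid" where
  "E0 = B0 Mod (j0 ` kernel A0 A \<alpha>)"

text \<open>\<open>p0\<close> is constant on every coset in \<open>E0\<close>, so that \<open>p0 ` e\<close> is a singleton.\<close>

definition \<pi> :: "'b0 set \<Rightarrow> 'g0" where
  "\<pi> e = the_elem (p0 ` e)"

text \<open>\<open>i (\<alpha> a\<^sub>0)\<close> is the coset of \<open>j0 a\<^sub>0\<close>, which does not depend on the preimage \<open>a\<^sub>0\<close>.\<close>

definition i :: "'a \<Rightarrow> 'b0 set" where
  "i a = (j0 ` kernel A0 A \<alpha>) #>\<^bsub>B0\<^esub> j0 (inv_into (carrier A0) \<alpha> a)"

definition prolongation ::
  "'b monoid \<Rightarrow> ('a \<Rightarrow> 'b) \<Rightarrow> ('b \<Rightarrow> 'g) \<Rightarrow> ('b0 \<Rightarrow> 'b) \<Rightarrow> bool" where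
  "prolongation B j p \<beta> \<longleftrightarrow>
     short_exact A j B p G \<and> \<beta> \<in> hom B0 B \<and>
     (\<forall>a\<in>carrier A0. \<beta> (j0 a) = j (\<alpha> a)) \<and>
     (\<forall>b\<in>carrier B0. p (\<beta> b) = \<gamma> (p0 b))"

text \<open>
  The homomorphism \<open>E0 \<rightarrow> B\<close> induced by the map \<open>\<beta>\<close> of a prolongation.
\<close>

definition induced :: "('b0 \<Rightarrow> 'b) \<Rightarrow> 'b0 set \<Rightarrow> 'b" where
  "induced \<beta> e = the_elem (\<beta> ` e)"

end

locale pre_prolongation = prolongation_data A0 j0 B0 p0 G0 A \<alpha> G \<gamma>
  for A0 :: "'a0 monoid" and j0 :: "'a0 \<Rightarrow> 'b0" and B0 :: "'b0 monoid"
    and p0 :: "'b0 \<Rightarrow> 'g0" and G0 :: "'g0 monoid"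
    and A :: "'a monoid" and \<alpha> :: "'a0 \<Rightarrow> 'a" and G :: "'g monoid" and \<gamma> :: "'g0 \<Rightarrow> 'g" +
  fixes \<theta> :: "'g \<Rightarrow> 'b0 set \<Rightarrow> 'b0 set"
  assumes crossed: "crossed_module E0 G (\<gamma> \<circ> \<pi>) \<theta>"
begin

text \<open>
  In a prolongation the induced map \<open>E0 \<rightarrow> B\<close> is injective onto the normal subgroup
  \<open>p\<inverse>(\<gamma> G\<^sub>0)\<close>, and conjugation in \<open>B\<close> descends to an action of \<open>G\<close> on \<open>E0\<close>.  A prolongation
  belongs to the pre-prolongation \<open>(\<alpha>, \<gamma>, \<theta>)\<close> if that action is \<open>\<theta>\<close>.  This does not follow
  from the remaining data: for \<open>A\<^sub>0 = A = \<int>/2\<close>, \<open>B\<^sub>0 = \<int>/2 \<times> \<int>\<close>, \<open>G\<^sub>0 = G = \<int>\<close>, \<open>\<alpha> = id\<close>,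
  \<open>\<gamma> = 2\<close> and \<open>\<theta>\<^sub>u(a, n) = (a + u n, n)\<close> the obstruction is the nonzero element of
  \<open>H\<^sup>3(\<int>/2, \<int>/2)\<close>, whereas \<open>B = \<int>/2 \<times> \<int>\<close>, \<open>\<beta> = id \<times> 2\<close> is a prolongation inducing the
  trivial action.
\<close>

definition induces_action :: "'b monoid \<Rightarrow> ('b \<Rightarrow> 'g) \<Rightarrow> ('b0 \<Rightarrow> 'b) \<Rightarrow> bool" where
  "induces_action B p \<beta> \<longleftrightarrow>
     (\<forall>b\<in>carrier B. \<forall>e\<in>carrier E0. induced \<beta> (\<theta> (p b) e) = conj_by B b (induced \<beta> e))"

text \<open>The \<open>Pi0\<close>-module structure of \<open>A\<close>; it does not depend on the representative of \<open>x\<close>.\<close>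

definition act :: "'g set \<Rightarrow> 'a \<Rightarrow> 'a" where
  "act x a = inv_into (carrier A) i (\<theta> (SOME u. u \<in> carrier G \<and> \<sigma> u = x) (i a))"

definition choice :: "('g set \<Rightarrow> 'g) \<Rightarrow> ('g set \<Rightarrow> 'g set \<Rightarrow> 'b0 set) \<Rightarrow> bool" where
  "choice u h \<longleftrightarrow>
     (\<forall>x\<in>carrier Pi0. u x \<in> carrier G \<and> \<sigma> (u x) = x) \<and> u \<one>\<^bsub>Pi0\<^esub> = \<one>\<^bsub>G\<^esub> \<and>
     (\<forall>x\<in>carrier Pi0. \<forall>y\<in>carrier Pi0. h x y \<in> carrier E0 \<and>
        \<gamma> (\<pi> (h x y)) = u x \<otimes>\<^bsub>G\<^esub> u y \<otimes>\<^bsub>G\<^esub> inv\<^bsub>G\<^esub> u (x \<otimes>\<^bsub>Pi0\<^esub> y)) \<and>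
     (\<forall>x\<in>carrier Pi0. h x \<one>\<^bsub>Pi0\<^esub> = \<one>\<^bsub>E0\<^esub> \<and> h \<one>\<^bsub>Pi0\<^esub> x = \<one>\<^bsub>E0\<^esub>)"

definition obstruction_cocycle ::
  "('g set \<Rightarrow> 'g) \<Rightarrow> ('g set \<Rightarrow> 'g set \<Rightarrow> 'b0 set) \<Rightarrow> 'g set \<Rightarrow> 'g set \<Rightarrow> 'g set \<Rightarrow> 'a" where
  "obstruction_cocycle u h x y z = (THE k. k \<in> carrier A \<and>
     \<theta> (u x) (h y z) \<otimes>\<^bsub>E0\<^esub> h x (y \<otimes>\<^bsub>Pi0\<^esub> z)
       = h x y \<otimes>\<^bsub>E0\<^esub> h (x \<otimes>\<^bsub>Pi0\<^esub> y) z \<otimes>\<^bsub>E0\<^esub> i k)"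

definition obstruction_class ::
  "('g set \<Rightarrow> 'g) \<Rightarrow> ('g set \<Rightarrow> 'g set \<Rightarrow> 'b0 set) \<Rightarrow> ('g set list \<Rightarrow> 'a) set" where
  "obstruction_class u h = cohomology_class Pi0 A act 3
     (\<lambda>xs\<in>tuples Pi0 3. obstruction_cocycle u h (xs ! 0) (xs ! 1) (xs ! 2))"

text \<open>The class of the cocycle does not depend on the choice of \<open>u\<close> and \<open>h\<close>.\<close>

definition Obs :: "('g set list \<Rightarrow> 'a) set" where
  "Obs = (let (u, h) = (SOME (u, h). choice u h) in obstruction_class u h)"

abbreviation H3 :: "('g set list \<Rightarrow> 'a) set monoid" where
  "H3 \<equiv> cohomology Pi0 A act 3"

text \<open>
  The middle group of a prolongation is in bijection with \<open>A \<times> G\<close>, so that existence of a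
  prolongation may be tested on groups with elements in \<open>'a \<times> 'g\<close>.
\<close>

lemma prolongation_transfer:
  fixes B :: "'b monoid"
  assumes prol: "prolongation B j p \<beta>" and ind: "induces_action B p \<beta>"
  shows "\<exists>(B' :: ('a \<times> 'g) monoid) j' p' \<beta>'. prolongation B' j' p' \<beta>' \<and> induces_action B' p' \<beta>'"
proof -
  have se: "short_exact A j B p G" and b: "\<beta> \<in> hom B0 B"
    and bj: "\<And>a. a \<in> carrier A0 \<Longrightarrow> \<beta> (j0 a) = j (\<alpha> a)"
    and pb: "\<And>b. b \<in> carrier B0 \<Longrightarrow> p (\<beta> b) = \<gamma> (p0 b)"
    using prol by (auto simp: prolongation_def)
  have gB: "group B" and j: "j \<in> mon A B" and p: "p \<in> epi B G"
    and jp: "j ` carrier A = kernel B G p"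
    using se by (auto simp: short_exact_def)
  have g0: "group B0" using exact by (simp add: short_exact_def)
  interpret B: group B by fact
  interpret G: group G by (rule group_G)
  interpret p: group_hom B G p
    using p by unfold_locales (auto simp: epi_def)
  define s where "s = (\<lambda>g. inv_into (carrier B) p g)"
  have s: "s g \<in> carrier B" "p (s g) = g" if "g \<in> carrier G" for g
    using p that by (auto simp: s_def epi_def inv_into_into f_inv_into_f)
  define \<psi> where "\<psi> = (\<lambda>b. (inv_into (carrier A) j (b \<otimes>\<^bsub>B\<^esub> inv\<^bsub>B\<^esub> s (p b)), p b))"
  have ker: "b \<otimes>\<^bsub>B\<^esub> inv\<^bsub>B\<^esub> s (p b) \<in> j ` carrier A" if "b \<in> carrier B" for b
    using that s[of "p b"] unfolding jp by (auto simp: kernel_def)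
  have inj: "inj_on \<psi> (carrier B)"
  proof (rule inj_onI)
    fix b c assume bc: "b \<in> carrier B" "c \<in> carrier B" "\<psi> b = \<psi> c"
    then have pe: "p b = p c" by (simp add: \<psi>_def)
    have "b \<otimes>\<^bsub>B\<^esub> inv\<^bsub>B\<^esub> s (p b) = c \<otimes>\<^bsub>B\<^esub> inv\<^bsub>B\<^esub> s (p c)"
      using bc ker[of b] ker[of c] unfolding \<psi>_def by (metis f_inv_into_f prod.inject)
    with pe bc s[of "p c"] show "b = c" by simp
  qed
  define \<phi> where "\<phi> = inv_into (carrier B) \<psi>"
  have \<phi>: "\<phi> (\<psi> b) = b" if "b \<in> carrier B" for b
    using that inj by (simp add: \<phi>_def)
  define B' where "B' = \<lparr>carrier = \<psi> ` carrier B,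
     monoid.mult = (\<lambda>x y. \<psi> (\<phi> x \<otimes>\<^bsub>B\<^esub> \<phi> y)), one = \<psi> \<one>\<^bsub>B\<^esub>\<rparr>"
  have cB': "carrier B' = \<psi> ` carrier B" by (simp add: B'_def)
  have iso: "\<psi> \<in> iso B B'"
    using inj by (auto simp: iso_def hom_def B'_def \<phi> bij_betw_def)
  have gB': "group B'"
  proof (rule groupI)
    fix x assume "x \<in> carrier B'"
    then obtain b where "b \<in> carrier B" "x = \<psi> b" by (auto simp: B'_def)
    then show "\<exists>y\<in>carrier B'. y \<otimes>\<^bsub>B'\<^esub> x = \<one>\<^bsub>B'\<^esub>"
      by (auto simp: B'_def \<phi> intro!: bexI[of _ "inv\<^bsub>B\<^esub> b"])
  qed (auto simp: B'_def \<phi> B.m_assoc)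
  have mB': "\<psi> b \<otimes>\<^bsub>B'\<^esub> \<psi> c = \<psi> (b \<otimes>\<^bsub>B\<^esub> c)" if "b \<in> carrier B" "c \<in> carrier B" for b c
    using that by (simp add: B'_def \<phi>)
  have invB': "inv\<^bsub>B'\<^esub> \<psi> b = \<psi> (inv\<^bsub>B\<^esub> b)" if "b \<in> carrier B" for b
    using that by (intro group.inv_equality[OF gB']) (auto simp: cB' mB', simp add: B'_def)
  have jc: "j a \<in> carrier B" if "a \<in> carrier A" for a using j that by (auto simp: mon_def hom_def)
  have bc: "\<beta> x \<in> carrier B" if "x \<in> carrier B0" for x using b that by (auto simp: hom_def)
  have "short_exact A (\<psi> \<circ> j) B' (p \<circ> \<phi>) G"
    unfolding short_exact_def
  proof (intro conjI group_A group_G gB')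
    show "\<psi> \<circ> j \<in> mon A B'"
      using j iso by (auto simp: iso_iff_mon_epi intro: mon_compose)
    have "p \<circ> \<phi> \<in> hom B' G"
      by (auto simp: hom_def B'_def \<phi>)
    moreover have "(p \<circ> \<phi>) ` carrier B' = carrier G"
    proof -
      have "(p \<circ> \<phi>) ` carrier B' = p ` carrier B"
        by (force simp: cB' \<phi> image_image)
      then show ?thesis using p by (simp add: epi_def)
    qed
    ultimately show "p \<circ> \<phi> \<in> epi B' G" by (simp add: epi_def)
    have "kernel B' G (p \<circ> \<phi>) = \<psi> ` kernel B G p"
      by (auto simp: kernel_def cB' \<phi>)
    then show "(\<psi> \<circ> j) ` carrier A = kernel B' G (p \<circ> \<phi>)"
      by (simp add: jp[symmetric] image_comp)
  qed
  then have 1: "prolongation B' (\<psi> \<circ> j) (p \<circ> \<phi>) (\<psi> \<circ> \<beta>)"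
    using b bj pb bc by (auto simp: prolongation_def \<phi> hom_def cB' mB')
  have ind': "induced (\<psi> \<circ> \<beta>) e = \<psi> (induced \<beta> e) \<and> induced \<beta> e \<in> carrier B"
    if "e \<in> carrier E0" for e
  proof -
    obtain x where x: "x \<in> carrier B0" "e = (j0 ` kernel A0 A \<alpha>) #>\<^bsub>B0\<^esub> x"
      using \<open>e \<in> carrier E0\<close> by (auto simp: E0_def FactGroup_def RCOSETS_def)
    interpret B0: group B0 by (rule g0)
    interpret A0: group A0 using exact by (simp add: short_exact_def)
    interpret A: group A by (rule group_A)
    interpret al: group_hom A0 A \<alpha> using alpha by unfold_locales (auto simp: epi_def)
    interpret jh: group_hom A B j using j by unfold_locales (auto simp: mon_def)
    interpret j0h: group_hom A0 B0 j0
      using exact by unfold_locales (auto simp: short_exact_def mon_def)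
    interpret bh: group_hom B0 B \<beta> using b by unfold_locales
    have "\<beta> y = \<beta> x" if "y \<in> e" for y
      using that x by (auto simp: r_coset_def kernel_def bj bc)
    moreover have "x \<in> e"
      unfolding x r_coset_def using x(1) A0.one_closed al.hom_one j0h.hom_one
      by (force simp: kernel_def intro!: bexI[of _ "\<one>\<^bsub>A0\<^esub>"])
    ultimately have img: "\<beta> ` e = {\<beta> x}" by blast
    then have "(\<psi> \<circ> \<beta>) ` e = {\<psi> (\<beta> x)}" by (metis image_comp image_empty image_insert)
    with img show ?thesis using x(1) bc by (simp add: induced_def)
  qed
  have \<theta>E: "\<theta> g e \<in> carrier E0" if "g \<in> carrier G" "e \<in> carrier E0" for g e
    using crossed that unfolding crossed_module_def
    by (auto simp: AutoGroup_def auto_def hom_def Pi_iff)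
  have "induces_action B' (p \<circ> \<phi>) (\<psi> \<circ> \<beta>)"
    using ind by (auto simp: induces_action_def cB' mB' invB' \<phi> ind' \<theta>E conj_by_def)
  with 1 show ?thesis by blast
qed

end

end

theory Submission
  imports Defs
begin

text \<open>
  Fix representatives \<open>u\<close> and a lift \<open>h\<close> of their defect \<open>f\<close> to \<open>E0\<close>.  Every other lift is
  \<open>h - c\<close> for a 2-cochain \<open>c\<close> with values in \<open>A\<close>, and since \<open>A\<close> is central in \<open>E0\<close>, the cocycle
  of \<open>h - c\<close> is \<open>k - \<delta>c\<close>.  Hence the obstruction vanishes iff some lift \<open>g\<close>, not necessarily
  normalised, satisfies \<open>\<phi>(x) g(y,z) + g(x,yz) = g(x,y) + g(xy,z)\<close>.  Such a \<open>g\<close> is precisely a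
  factor set for an extension of \<open>\<Pi>\<^sub>0\<close> by the non-abelian group \<open>E0\<close>, and the resulting group
  \<open>E0 \<times> \<Pi>\<^sub>0\<close> maps onto \<open>G\<close> by \<open>(e, x) \<mapsto> \<gamma> (\<pi> e) + u x\<close> with kernel \<open>A\<close>.  Conversely, lifting
  the \<open>u x\<close> to the middle group \<open>B\<close> of a prolongation yields such a \<open>g\<close>, because \<open>E0\<close> is the
  preimage of \<open>\<gamma> G\<^sub>0\<close> in \<open>B\<close>.
\<close>

text \<open>Products are normalised by re-association to the right, which buries adjacent inverse
  pairs in longer products; these rules cancel them there.\<close>

lemma (in group) inv_mult_cancel [simp]:
  assumes "x \<in> carrier G" "y \<in> carrier G"
  shows "inv x \<otimes> (x \<otimes> y) = y" "x \<otimes> (inv x \<otimes> y) = y"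
  using assms by (simp_all flip: m_assoc)

section \<open>Cohomology classes\<close>

lemma group_cochains: "group A \<Longrightarrow> group (cochains P A n)"
  by (simp add: cochains_def)

lemma carrier_cochains: "carrier (cochains P A n) = tuples P n \<rightarrow>\<^sub>E carrier A"
  by (simp add: cochains_def)

lemma mult_cochains:
  "f \<otimes>\<^bsub>cochains P A n\<^esub> g = (\<lambda>xs\<in>tuples P n. f xs \<otimes>\<^bsub>A\<^esub> g xs)"
  by (simp add: cochains_def)

text \<open>Each term of the differential is additive in the cochain: the first because
  \<open>act x\<close> is an endomorphism, the signed ones because \<open>A\<close> is abelian.
  Hence the coboundaries form a subgroup.\<close>

lemma coboundary_in_hom:
  assumes "group P" "comm_group A" and act: "\<And>x. x \<in> carrier P \<Longrightarrow> act x \<in> hom A A"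
  shows "coboundary P A act n \<in> hom (cochains P A n) (cochains P A (Suc n))"
proof -
  interpret P: group P by fact
  interpret A: comm_group A by fact
  have face: "take i xs @ (xs ! i \<otimes>\<^bsub>P\<^esub> xs ! Suc i) # drop (i + 2) xs \<in> tuples P n"
    if "xs \<in> tuples P (Suc n)" "i < n" for xs i
    using that by (auto simp: tuples_def dest!: in_set_takeD in_set_dropD intro!: P.m_closed)
  have ends: "hd xs \<in> carrier P" "tl xs \<in> tuples P n" "butlast xs \<in> tuples P n"
    if "xs \<in> tuples P (Suc n)" for xs
    using that by (auto simp: tuples_def length_Suc_conv dest!: in_set_butlastD)
  have val: "f xs \<in> carrier A" if "f \<in> carrier (cochains P A n)" "xs \<in> tuples P n" for f xs
    using that by (auto simp: carrier_cochains)
  have act_closed: "act x a \<in> carrier A" if "x \<in> carrier P" "a \<in> carrier A" for x a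
    using act that by (auto simp: hom_def)
  have act_mult: "act x (a \<otimes>\<^bsub>A\<^esub> b) = act x a \<otimes>\<^bsub>A\<^esub> act x b"
    if "x \<in> carrier P" "a \<in> carrier A" "b \<in> carrier A" for x a b
    using act that by (auto simp: hom_def)
  show ?thesis
  proof (rule homI)
    fix f assume f: "f \<in> carrier (cochains P A n)"
    have "coboundary P A act n f xs \<in> carrier A" if "xs \<in> tuples P (Suc n)" for xs
      unfolding coboundary_def using that f face ends
      by (auto simp: val act_closed Pi_def simp del: power_Suc
          intro!: A.m_closed A.finprod_closed A.int_pow_closed)
    then show "coboundary P A act n f \<in> carrier (cochains P A (Suc n))"
      by (auto simp: carrier_cochains[of _ _ "Suc n"]) (simp add: coboundary_def)
  next
    fix f g assume fg: "f \<in> carrier (cochains P A n)" "g \<in> carrier (cochains P A n)"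
    have "coboundary P A act n (f \<otimes>\<^bsub>cochains P A n\<^esub> g) xs
        = coboundary P A act n f xs \<otimes>\<^bsub>A\<^esub> coboundary P A act n g xs"
      if xs: "xs \<in> tuples P (Suc n)" for xs
    proof -
      \<comment> \<open>The signed inner faces as a function of the cochain, so that their product
        over \<open>i\<close> can be split factor by factor.\<close>
      define F where "F = (\<lambda>f i. f (take i xs @ (xs ! i \<otimes>\<^bsub>P\<^esub> xs ! Suc i) # drop (i + 2) xs)
        [^]\<^bsub>A\<^esub> ((- 1) ^ Suc i :: int))"
      have F: "F f \<in> {..<n} \<rightarrow> carrier A" "F g \<in> {..<n} \<rightarrow> carrier A"
        using fg face[OF xs] by (auto simp: F_def val)
      have "(\<Otimes>\<^bsub>A\<^esub>i\<in>{..<n}. F (f \<otimes>\<^bsub>cochains P A n\<^esub> g) i)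
        = (\<Otimes>\<^bsub>A\<^esub>i\<in>{..<n}. F f i \<otimes>\<^bsub>A\<^esub> F g i)"
        using fg face[OF xs] F by (intro A.finprod_cong')
          (auto simp: F_def mult_cochains val A.int_pow_distrib simp del: power_Suc)
      also have "\<dots> = (\<Otimes>\<^bsub>A\<^esub>i\<in>{..<n}. F f i) \<otimes>\<^bsub>A\<^esub> (\<Otimes>\<^bsub>A\<^esub>i\<in>{..<n}. F g i)"
        using F by (rule A.finprod_multf)
      finally have "(\<Otimes>\<^bsub>A\<^esub>i\<in>{..<n}. F (f \<otimes>\<^bsub>cochains P A n\<^esub> g) i)
        = (\<Otimes>\<^bsub>A\<^esub>i\<in>{..<n}. F f i) \<otimes>\<^bsub>A\<^esub> (\<Otimes>\<^bsub>A\<^esub>i\<in>{..<n}. F g i)" .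
      moreover have "coboundary P A act n k xs = act (hd xs) (k (tl xs))
          \<otimes>\<^bsub>A\<^esub> (\<Otimes>\<^bsub>A\<^esub>i\<in>{..<n}. F k i) \<otimes>\<^bsub>A\<^esub> k (butlast xs) [^]\<^bsub>A\<^esub> ((- 1) ^ Suc n :: int)" for k
        using xs by (simp only: coboundary_def F_def restrict_apply')
      ultimately show ?thesis
        using ends[OF xs] fg A.finprod_closed[OF F(1)] A.finprod_closed[OF F(2)]
        by (simp add: mult_cochains val act_closed act_mult A.int_pow_distrib A.m_ac
            del: power_Suc)
    qed
    \<comment> \<open>Equality of functions also compares values off the tuples, where both sides
      take the default value.\<close>
    moreover have "coboundary P A act n k xs = undefined" if "xs \<notin> tuples P (Suc n)" for k xs
      using that by (simp add: coboundary_def)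
    ultimately show "coboundary P A act n (f \<otimes>\<^bsub>cochains P A n\<^esub> g)
      = coboundary P A act n f \<otimes>\<^bsub>cochains P A (Suc n)\<^esub> coboundary P A act n g"
      by (auto simp: mult_cochains[where n = "Suc n"] fun_eq_iff restrict_def)
  qed
qed

text \<open>The unit of the quotient is the subgroup of coboundaries itself, and a coset of a
  subgroup equals it exactly when its representative lies in it. Both are computed in the cochain
  group, whose multiplication \<open>cocycles\<close> inherits.\<close>

lemma cohomology_class_eq_one_iff:
  assumes "group P" "comm_group A" "\<And>x. x \<in> carrier P \<Longrightarrow> act x \<in> hom A A"
    and k: "k \<in> carrier (cochains P A (Suc n))"
  shows "cohomology_class P A act (Suc n) k = \<one>\<^bsub>cohomology P A act (Suc n)\<^esub>
    \<longleftrightarrow> k \<in> coboundary P A act n ` carrier (cochains P A n)" (is "_ \<longleftrightarrow> k \<in> ?C")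
proof -
  have A: "group A" using assms(2) by (rule comm_group.axioms(2))
  interpret d: group_hom "cochains P A n" "cochains P A (Suc n)" "coboundary P A act n"
    using coboundary_in_hom[OF assms(1-3), where n = n] group_cochains[OF A]
    by (auto simp: group_hom_def group_hom_axioms_def)
  have sub: "subgroup ?C (cochains P A (Suc n))"
    by (rule d.img_is_subgroup)
  have "cohomology_class P A act (Suc n) k = ?C #>\<^bsub>cochains P A (Suc n)\<^esub> k"
    by (simp add: cohomology_class_def r_coset_def cocycles_def)
  moreover have "\<one>\<^bsub>cohomology P A act (Suc n)\<^esub> = ?C"
    by (simp add: cohomology_def FactGroup_def)
  ultimately show ?thesis
    using d.H.coset_join1[OF _ k sub] d.H.coset_join2[OF k sub] by auto
qed

text \<open>The signs after the leading term are -1, 1, -1. The two negative terms are collected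
  under one inverse, so that the positive and negative parts match the two sides of the factor set
  identity.\<close>

lemma coboundary_2:
  assumes "group P" "comm_group A" "\<And>x. x \<in> carrier P \<Longrightarrow> act x \<in> hom A A"
    and f: "f \<in> carrier (cochains P A 2)"
    and xyz: "x \<in> carrier P" "y \<in> carrier P" "z \<in> carrier P"
  shows "coboundary P A act 2 f [x, y, z]
    = act x (f [y, z]) \<otimes>\<^bsub>A\<^esub> f [x, y \<otimes>\<^bsub>P\<^esub> z] \<otimes>\<^bsub>A\<^esub> inv\<^bsub>A\<^esub> (f [x, y] \<otimes>\<^bsub>A\<^esub> f [x \<otimes>\<^bsub>P\<^esub> y, z])"
proof -
  interpret P: group P by fact
  interpret A: comm_group A by fact
  have val: "f [v, w] \<in> carrier A" if "v \<in> carrier P" "w \<in> carrier P" for v w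
    using that f by (auto simp: carrier_cochains tuples_def)
  have "act x (f [y, z]) \<in> carrier A"
    using assms(3)[OF xyz(1)] val[OF xyz(2,3)] by (auto simp: hom_def)
  moreover have "{..<2} = {0, 1::nat}" by auto
  ultimately show ?thesis
    using xyz by (simp add: coboundary_def tuples_def val A.int_pow_neg A.inv_mult A.m_ac)
qed

section \<open>Extensions with non-abelian kernel\<close>

text \<open>The normalisations \<open>h x \<one> = \<one>\<close> and \<open>h \<one> x = \<one>\<close> are not imposed, so that
  the neutral element of the extension is \<open>(inv h \<one> \<one>, \<one>)\<close>.\<close>

locale factor_system = E: group E + P: group P
  for E :: "'e monoid" and P :: "'x monoid" +
  fixes \<phi> :: "'x \<Rightarrow> 'e \<Rightarrow> 'e" and h :: "'x \<Rightarrow> 'x \<Rightarrow> 'e"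
  assumes phi_hom: "x \<in> carrier P \<Longrightarrow> \<phi> x \<in> hom E E"
    and phi_one: "e \<in> carrier E \<Longrightarrow> \<phi> \<one>\<^bsub>P\<^esub> e = e"
    and h_closed [simp]: "x \<in> carrier P \<Longrightarrow> y \<in> carrier P \<Longrightarrow> h x y \<in> carrier E"
    and phi_phi: "x \<in> carrier P \<Longrightarrow> y \<in> carrier P \<Longrightarrow> e \<in> carrier E \<Longrightarrow>
      \<phi> x (\<phi> y e) = conj_by E (h x y) (\<phi> (x \<otimes>\<^bsub>P\<^esub> y) e)"
    and cocycle: "x \<in> carrier P \<Longrightarrow> y \<in> carrier P \<Longrightarrow> z \<in> carrier P \<Longrightarrow>
      \<phi> x (h y z) \<otimes>\<^bsub>E\<^esub> h x (y \<otimes>\<^bsub>P\<^esub> z) = h x y \<otimes>\<^bsub>E\<^esub> h (x \<otimes>\<^bsub>P\<^esub> y) z"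
begin

lemma phi_closed [simp]: "x \<in> carrier P \<Longrightarrow> e \<in> carrier E \<Longrightarrow> \<phi> x e \<in> carrier E"
  using phi_hom by (auto simp: hom_def)

lemma phi_mult [simp]:
  "x \<in> carrier P \<Longrightarrow> e \<in> carrier E \<Longrightarrow> f \<in> carrier E \<Longrightarrow> \<phi> x (e \<otimes>\<^bsub>E\<^esub> f) = \<phi> x e \<otimes>\<^bsub>E\<^esub> \<phi> x f"
  using phi_hom by (auto simp: hom_def)

lemma phi_inv: "x \<in> carrier P \<Longrightarrow> e \<in> carrier E \<Longrightarrow> \<phi> x (inv\<^bsub>E\<^esub> e) = inv\<^bsub>E\<^esub> \<phi> x e"
  using phi_hom by (simp add: group_hom.hom_inv group_hom_axioms_def group_hom_def)

abbreviation n where "n \<equiv> h \<one>\<^bsub>P\<^esub> \<one>\<^bsub>P\<^esub>"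

text \<open>For \<open>x = y = \<one>\<close> the law \<open>phi_phi\<close> says that conjugation
  by \<open>n\<close> is the identity.\<close>

lemma n_central: "e \<in> carrier E \<Longrightarrow> n \<otimes>\<^bsub>E\<^esub> e = e \<otimes>\<^bsub>E\<^esub> n"
  using phi_phi[of "\<one>\<^bsub>P\<^esub>" "\<one>\<^bsub>P\<^esub>" e] E.inv_solve_right[of e "n \<otimes>\<^bsub>E\<^esub> e" n]
  by (simp add: phi_one conj_by_def)

text \<open>This and the next rule come from the cocycle identity at (1, 1, x) and at (x, 1, 1),
  where a common factor cancels.\<close>

lemma h_one_left: "x \<in> carrier P \<Longrightarrow> h \<one>\<^bsub>P\<^esub> x = n"
  using cocycle[of "\<one>\<^bsub>P\<^esub>" "\<one>\<^bsub>P\<^esub>" x] by (simp add: phi_one)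

lemma h_one_right: "x \<in> carrier P \<Longrightarrow> h x \<one>\<^bsub>P\<^esub> = \<phi> x n"
  using cocycle[of x "\<one>\<^bsub>P\<^esub>" "\<one>\<^bsub>P\<^esub>"] by simp

text \<open>Schreier's crossed product: \<open>(e, x)\<close> stands for \<open>e\<close> times a
  fixed lift of \<open>x\<close>. Moving \<open>f\<close> to the left past that lift applies
  \<open>\<phi> x\<close>, and multiplying the lifts of \<open>x\<close> and \<open>y\<close>
  produces \<open>h x y\<close>.\<close>

definition extension :: "('e \<times> 'x) monoid" where
  "extension = \<lparr>carrier = carrier E \<times> carrier P,
     monoid.mult = (\<lambda>(e, x) (f, y). (e \<otimes>\<^bsub>E\<^esub> \<phi> x f \<otimes>\<^bsub>E\<^esub> h x y, x \<otimes>\<^bsub>P\<^esub> y)),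
     one = (inv\<^bsub>E\<^esub> n, \<one>\<^bsub>P\<^esub>)\<rparr>"

lemma carrier_extension: "carrier extension = carrier E \<times> carrier P"
  by (simp add: extension_def)

lemma mult_extension:
  "(e, x) \<otimes>\<^bsub>extension\<^esub> (f, y) = (e \<otimes>\<^bsub>E\<^esub> \<phi> x f \<otimes>\<^bsub>E\<^esub> h x y, x \<otimes>\<^bsub>P\<^esub> y)"
  by (simp add: extension_def)

lemma one_extension: "\<one>\<^bsub>extension\<^esub> = (inv\<^bsub>E\<^esub> n, \<one>\<^bsub>P\<^esub>)"
  by (simp add: extension_def)

lemma group_extension: "group extension"
proof (rule groupI)
  fix a b c assume "a \<in> carrier extension" "b \<in> carrier extension" "c \<in> carrier extension"
  then obtain e x f y g z where *: "a = (e, x)" "b = (f, y)" "c = (g, z)"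
    "e \<in> carrier E" "f \<in> carrier E" "g \<in> carrier E" "x \<in> carrier P" "y \<in> carrier P" "z \<in> carrier P"
    by (auto simp: carrier_extension)
  \<comment> \<open>The core of associativity: \<open>phi_phi\<close> leaves an inverse of
    \<open>h x y\<close> that cancels the \<open>h x y\<close> produced by
    \<open>cocycle\<close>.\<close>
  have "\<phi> x (\<phi> y g) \<otimes>\<^bsub>E\<^esub> (\<phi> x (h y z) \<otimes>\<^bsub>E\<^esub> h x (y \<otimes>\<^bsub>P\<^esub> z))
    = h x y \<otimes>\<^bsub>E\<^esub> (\<phi> (x \<otimes>\<^bsub>P\<^esub> y) g \<otimes>\<^bsub>E\<^esub> h (x \<otimes>\<^bsub>P\<^esub> y) z)"
    using * by (simp add: cocycle phi_phi conj_by_def E.m_assoc)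
  with * show "a \<otimes>\<^bsub>extension\<^esub> b \<otimes>\<^bsub>extension\<^esub> c = a \<otimes>\<^bsub>extension\<^esub> (b \<otimes>\<^bsub>extension\<^esub> c)"
    by (simp add: mult_extension E.m_assoc P.m_assoc)
next
  fix a assume "a \<in> carrier extension"
  then obtain e x where *: "a = (e, x)" "e \<in> carrier E" "x \<in> carrier P"
    by (auto simp: carrier_extension)
  then show "\<one>\<^bsub>extension\<^esub> \<otimes>\<^bsub>extension\<^esub> a = a"
    using n_central[of e, symmetric]
    by (simp add: mult_extension one_extension phi_one h_one_left[of x] E.m_assoc)
  \<comment> \<open>Obtained by solving the product formula for a left factor over the inverse of
    \<open>x\<close> that gives first coordinate \<open>inv n\<close>.\<close>
  let ?e = "inv\<^bsub>E\<^esub> n \<otimes>\<^bsub>E\<^esub> inv\<^bsub>E\<^esub> (\<phi> (inv\<^bsub>P\<^esub> x) e \<otimes>\<^bsub>E\<^esub> h (inv\<^bsub>P\<^esub> x) x)"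
  have "(?e, inv\<^bsub>P\<^esub> x) \<otimes>\<^bsub>extension\<^esub> a = \<one>\<^bsub>extension\<^esub>"
    using * by (simp add: mult_extension one_extension E.m_assoc)
  moreover have "(?e, inv\<^bsub>P\<^esub> x) \<in> carrier extension"
    using * by (simp add: carrier_extension)
  ultimately show "\<exists>b\<in>carrier extension. b \<otimes>\<^bsub>extension\<^esub> a = \<one>\<^bsub>extension\<^esub>" by blast
qed (auto simp: carrier_extension mult_extension one_extension)

text \<open>The product of \<open>(e, \<one>)\<close> and \<open>(f, \<one>)\<close> has first
  coordinate \<open>e f n\<close>; the factor \<open>inv n\<close> corrects this and sends the unit
  to the unit.\<close>

definition kernel_emb :: "'e \<Rightarrow> 'e \<times> 'x" where
  "kernel_emb e = (e \<otimes>\<^bsub>E\<^esub> inv\<^bsub>E\<^esub> n, \<one>\<^bsub>P\<^esub>)"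

lemma kernel_emb_hom: "kernel_emb \<in> hom E extension"
proof (rule homI)
  fix e f assume "e \<in> carrier E" "f \<in> carrier E"
  moreover from this have "inv\<^bsub>E\<^esub> n \<otimes>\<^bsub>E\<^esub> f = f \<otimes>\<^bsub>E\<^esub> inv\<^bsub>E\<^esub> n"
    using n_central[of "inv\<^bsub>E\<^esub> f"] by (metis E.inv_closed E.inv_inv E.inv_mult_group P.one_closed h_closed)
  ultimately show "kernel_emb (e \<otimes>\<^bsub>E\<^esub> f) = kernel_emb e \<otimes>\<^bsub>extension\<^esub> kernel_emb f"
    by (simp add: kernel_emb_def mult_extension phi_one E.m_assoc)
qed (simp add: kernel_emb_def carrier_extension)

lemma kernel_emb_inj: "inj_on kernel_emb (carrier E)"
  by (rule inj_onI) (simp add: kernel_emb_def)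

text \<open>The \<open>inv n\<close> inside \<open>kernel_emb\<close> cancels
  \<open>h x \<one> = \<phi> x n\<close> or \<open>h \<one> x = n\<close>, leaving the formulas of a
  semidirect product.\<close>

lemma mult_kernel_emb:
  assumes "e \<in> carrier E" "x \<in> carrier P" "f \<in> carrier E"
  shows "(e, x) \<otimes>\<^bsub>extension\<^esub> kernel_emb f = (e \<otimes>\<^bsub>E\<^esub> \<phi> x f, x)"
    "kernel_emb f \<otimes>\<^bsub>extension\<^esub> (e, x) = (f \<otimes>\<^bsub>E\<^esub> e, x)"
  using assms n_central[of e, symmetric]
  by (simp_all add: kernel_emb_def mult_extension phi_one phi_inv h_one_left[of x] h_one_right[of x] E.m_assoc)

text \<open>Identifies the conjugation action of the extension on its kernel. It is checked in the
  form \<open>a b = c a\<close>, which avoids computing an inverse in the extension.\<close>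

lemma conj_kernel_emb:
  assumes "e \<in> carrier E" "x \<in> carrier P" "f \<in> carrier E"
  shows "conj_by extension (e, x) (kernel_emb f) = kernel_emb (conj_by E e (\<phi> x f))"
proof -
  interpret X: group extension by (rule group_extension)
  have c: "(e, x) \<in> carrier extension" "kernel_emb f \<in> carrier extension"
    "kernel_emb (conj_by E e (\<phi> x f)) \<in> carrier extension"
    using assms by (simp_all add: carrier_extension kernel_emb_def conj_by_def)
  have "(e, x) \<otimes>\<^bsub>extension\<^esub> kernel_emb f = kernel_emb (conj_by E e (\<phi> x f)) \<otimes>\<^bsub>extension\<^esub> (e, x)"
    using assms by (simp add: mult_kernel_emb conj_by_def E.m_assoc)
  with c show ?thesis unfolding conj_by_def[of extension] by (simp add: X.m_assoc)
qed

end

section \<open>The quotient groups of a prolongation problem\<close>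

sublocale prolongation_data \<subseteq> A0: group A0
  using exact by (simp add: short_exact_def)
sublocale prolongation_data \<subseteq> B0: group B0
  using exact by (simp add: short_exact_def)
sublocale prolongation_data \<subseteq> G0: group G0
  using exact by (simp add: short_exact_def)
sublocale prolongation_data \<subseteq> A: group A by (rule group_A)
sublocale prolongation_data \<subseteq> G: group G by (rule group_G)
sublocale prolongation_data \<subseteq> \<alpha>: group_hom A0 A \<alpha>
  using alpha by unfold_locales (simp add: epi_def)
sublocale prolongation_data \<subseteq> j0: group_hom A0 B0 j0
  using exact by unfold_locales (simp add: short_exact_def mon_def)
sublocale prolongation_data \<subseteq> p0: group_hom B0 G0 p0
  using exact by unfold_locales (simp add: short_exact_def epi_def)
sublocale prolongation_data \<subseteq> \<gamma>: group_hom G0 G \<gamma>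
  using gamma by unfold_locales (simp add: mon_def)

context prolongation_data
begin

abbreviation N :: "'b0 set" where "N \<equiv> j0 ` kernel A0 A \<alpha>"

definition cls :: "'b0 \<Rightarrow> 'b0 set" where
  "cls b = N #>\<^bsub>B0\<^esub> b"

lemma alpha_surj: "\<alpha> ` carrier A0 = carrier A"
  using alpha by (simp add: epi_def)

lemma A_cases:
  assumes "a \<in> carrier A"
  obtains a0 where "a0 \<in> carrier A0" "a = \<alpha> a0"
  using assms alpha_surj by blast

lemma j0_inj: "inj_on j0 (carrier A0)"
  using exact by (simp add: short_exact_def mon_def)

lemma p0_surj: "p0 ` carrier B0 = carrier G0"
  using exact by (simp add: short_exact_def epi_def)

lemma j0_image: "j0 ` carrier A0 = kernel B0 G0 p0"
  using exact by (simp add: short_exact_def)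

lemma gamma_inj: "inj_on \<gamma> (carrier G0)"
  using gamma by (simp add: mon_def)

lemma p0_j0 [simp]: "a \<in> carrier A0 \<Longrightarrow> p0 (j0 a) = \<one>\<^bsub>G0\<^esub>"
  using j0_image by (auto simp: kernel_def)

text \<open>\<open>j0\<close> embeds \<open>A0\<close> in the center of \<open>B0\<close>, so
  \<open>A0\<close> is abelian, and \<open>A\<close> is a quotient of it.\<close>

lemma A_comm: "a \<in> carrier A \<Longrightarrow> b \<in> carrier A \<Longrightarrow> a \<otimes>\<^bsub>A\<^esub> b = b \<otimes>\<^bsub>A\<^esub> a"
proof -
  assume "a \<in> carrier A" "b \<in> carrier A"
  then obtain a0 b0 where *: "a0 \<in> carrier A0" "b0 \<in> carrier A0" "a = \<alpha> a0" "b = \<alpha> b0"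
    by (metis A_cases)
  then have "j0 (a0 \<otimes>\<^bsub>A0\<^esub> b0) = j0 (b0 \<otimes>\<^bsub>A0\<^esub> a0)"
    using central[of a0 "j0 b0"] by simp
  with * have "a0 \<otimes>\<^bsub>A0\<^esub> b0 = b0 \<otimes>\<^bsub>A0\<^esub> a0"
    using inj_onD[OF j0_inj] by auto
  with * show ?thesis by (simp flip: \<alpha>.hom_mult)
qed

lemma N_normal: "N \<lhd> B0"
proof (rule B0.normal_invI)
  show "subgroup N B0"
    by (rule j0.subgroup_img_is_subgroup[OF \<alpha>.subgroup_kernel])
  show "x \<otimes>\<^bsub>B0\<^esub> h \<otimes>\<^bsub>B0\<^esub> inv\<^bsub>B0\<^esub> x \<in> N" if "x \<in> carrier B0" "h \<in> N" for x h
  proof -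
    from that obtain k where k: "k \<in> kernel A0 A \<alpha>" "h = j0 k" by auto
    then have "k \<in> carrier A0" by (simp add: kernel_def)
    with k that(1) have "x \<otimes>\<^bsub>B0\<^esub> h \<otimes>\<^bsub>B0\<^esub> inv\<^bsub>B0\<^esub> x = h"
      by (simp add: central[symmetric] B0.m_assoc)
    with that show ?thesis by simp
  qed
qed

end

sublocale prolongation_data \<subseteq> E0: group E0
  unfolding E0_def by (rule normal.factorgroup_is_group[OF N_normal])
sublocale prolongation_data \<subseteq> cls: group_hom B0 E0 cls
  using normal.r_coset_hom_Mod[OF N_normal]
  by unfold_locales (simp add: E0_def cls_def[abs_def])
sublocale prolongation_data \<subseteq> Pi0: group Pi0
  unfolding Pi0_def by (rule normal.factorgroup_is_group[OF gamma_normal])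
sublocale prolongation_data \<subseteq> \<sigma>: group_hom G Pi0 \<sigma>
  using normal.r_coset_hom_Mod[OF gamma_normal]
  by unfold_locales (simp add: Pi0_def \<sigma>_def[abs_def])

context prolongation_data
begin

section \<open>The projections onto \<open>E0\<close> and \<open>Pi0\<close>, and the maps
  \<open>\<pi>\<close> and \<open>i\<close>\<close>

lemma cls_surj: "cls ` carrier B0 = carrier E0"
  by (auto simp: cls_def E0_def FactGroup_def RCOSETS_def)

lemma E0_cases:
  assumes "e \<in> carrier E0"
  obtains b where "b \<in> carrier B0" "e = cls b"
  using assms cls_surj by blast

lemma sigma_surj: "\<sigma> ` carrier G = carrier Pi0"
  by (auto simp: \<sigma>_def Pi0_def FactGroup_def RCOSETS_def)

lemma sigma_eq_one_iff:
  assumes "u \<in> carrier G"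
  shows "\<sigma> u = \<one>\<^bsub>Pi0\<^esub> \<longleftrightarrow> u \<in> \<gamma> ` carrier G0"
  using assms normal_imp_subgroup[OF gamma_normal] G.coset_join1[of _ u] G.coset_join2[of u]
  unfolding \<sigma>_def Pi0_def by (auto simp: FactGroup_def)

lemma cls_eq_one_iff:
  assumes "b \<in> carrier B0"
  shows "cls b = \<one>\<^bsub>E0\<^esub> \<longleftrightarrow> b \<in> N"
  using assms normal_imp_subgroup[OF N_normal] B0.coset_join1[of N b] B0.coset_join2[of b N]
  unfolding cls_def E0_def by (auto simp: FactGroup_def)

text \<open>A homomorphism that kills \<open>N\<close> is constant on each coset, so its image there
  is a singleton. This evaluates both \<open>\<pi>\<close> and the maps \<open>induced\<close> by a
  prolongation.\<close>

lemma the_elem_image_cls: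
  assumes f: "group_hom B0 H f" and kill: "\<And>a. a \<in> kernel A0 A \<alpha> \<Longrightarrow> f (j0 a) = \<one>\<^bsub>H\<^esub>"
    and b: "b \<in> carrier B0"
  shows "the_elem (f ` cls b) = f b"
proof -
  interpret f: group_hom B0 H f by fact
  have "f y = f b" if "y \<in> cls b" for y
    using that b kill by (auto simp: cls_def r_coset_def kernel_def)
  moreover have "b \<in> cls b"
    unfolding cls_def using b N_normal by (simp add: B0.rcos_self normal_imp_subgroup)
  ultimately have "f ` cls b = {f b}" by blast
  then show ?thesis by simp
qed

lemma pi_cls [simp]: "b \<in> carrier B0 \<Longrightarrow> \<pi> (cls b) = p0 b"
  unfolding \<pi>_def by (rule the_elem_image_cls) (auto simp: kernel_def p0.group_hom_axioms)

text \<open>The preimage selected by \<open>inv_into\<close> differs from \<open>a\<close> by an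
  element of the kernel of \<open>\<alpha>\<close>, hence has the same coset; this removes the
  arbitrary preimage from all later arguments.\<close>

lemma i_alpha: "a \<in> carrier A0 \<Longrightarrow> i (\<alpha> a) = cls (j0 a)"
proof -
  assume a: "a \<in> carrier A0"
  define b where "b = inv_into (carrier A0) \<alpha> (\<alpha> a)"
  have b: "b \<in> carrier A0" "\<alpha> b = \<alpha> a"
    using a by (auto simp: b_def inv_into_into f_inv_into_f)
  then have "b \<otimes>\<^bsub>A0\<^esub> inv\<^bsub>A0\<^esub> a \<in> kernel A0 A \<alpha>"
    using a by (simp add: kernel_def)
  then have "cls (j0 (b \<otimes>\<^bsub>A0\<^esub> inv\<^bsub>A0\<^esub> a)) = \<one>\<^bsub>E0\<^esub>"
    using a b by (intro cls_eq_one_iff[THEN iffD2] j0.hom_closed imageI) simp_all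
  then have eq: "cls (j0 b) \<otimes>\<^bsub>E0\<^esub> inv\<^bsub>E0\<^esub> cls (j0 a) = \<one>\<^bsub>E0\<^esub>"
    using a b by simp
  have "cls (j0 b) = cls (j0 a)"
    using E0.inv_equality[OF eq] a b by simp
  then show ?thesis by (simp add: i_def cls_def b_def)
qed

lemma pi_hom: "\<pi> \<in> hom E0 G0"
proof (rule homI)
  show "\<pi> e \<in> carrier G0" if "e \<in> carrier E0" for e
    using that by (elim E0_cases) simp
  show "\<pi> (e \<otimes>\<^bsub>E0\<^esub> f) = \<pi> e \<otimes>\<^bsub>G0\<^esub> \<pi> f" if "e \<in> carrier E0" "f \<in> carrier E0" for e f
    using that by (elim E0_cases) (simp flip: cls.hom_mult)
qed

lemma i_hom: "i \<in> hom A E0"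
proof (rule homI)
  show "i a \<in> carrier E0" if "a \<in> carrier A" for a
    using that by (elim A_cases) (simp add: i_alpha)
  fix a b assume "a \<in> carrier A" "b \<in> carrier A"
  then obtain a0 b0 where *: "a0 \<in> carrier A0" "b0 \<in> carrier A0" "a = \<alpha> a0" "b = \<alpha> b0"
    by (metis A_cases)
  then show "i (a \<otimes>\<^bsub>A\<^esub> b) = i a \<otimes>\<^bsub>E0\<^esub> i b"
    by (simp add: i_alpha flip: \<alpha>.hom_mult)
qed

end

sublocale prolongation_data \<subseteq> \<pi>: group_hom E0 G0 \<pi>
  using pi_hom by unfold_locales
sublocale prolongation_data \<subseteq> i: group_hom A E0 i
  using i_hom by unfold_locales

context prolongation_data
begin

lemma i_inj: "inj_on i (carrier A)"
proof (rule i.inj_on_one_iff[THEN iffD2], intro allI impI)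
  fix a assume "a \<in> carrier A" "i a = \<one>\<^bsub>E0\<^esub>"
  then obtain a0 where a0: "a0 \<in> carrier A0" "a = \<alpha> a0" "cls (j0 a0) = \<one>\<^bsub>E0\<^esub>"
    by (metis A_cases i_alpha)
  then have "j0 a0 \<in> N" using cls_eq_one_iff by simp
  then have "a0 \<in> kernel A0 A \<alpha>"
    using a0 inj_onD[OF j0_inj] by (auto simp: kernel_def)
  with a0 show "a = \<one>\<^bsub>A\<^esub>" by (simp add: kernel_def)
qed

lemma pi_i [simp]: "a \<in> carrier A \<Longrightarrow> \<pi> (i a) = \<one>\<^bsub>G0\<^esub>"
  by (elim A_cases) (simp add: i_alpha)

text \<open>Exactness at \<open>E0\<close>, inherited from exactness at \<open>B0\<close>.\<close>

lemma pi_eq_oneE: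
  assumes "e \<in> carrier E0" "\<pi> e = \<one>\<^bsub>G0\<^esub>"
  obtains a where "a \<in> carrier A" "e = i a"
proof -
  obtain b where b: "b \<in> carrier B0" "e = cls b" using assms(1) by (rule E0_cases)
  with assms(2) have "b \<in> j0 ` carrier A0" by (simp add: j0_image kernel_def)
  with b obtain a0 where "a0 \<in> carrier A0" "e = cls (j0 a0)" by auto
  then show ?thesis using that[of "\<alpha> a0"] by (simp add: i_alpha)
qed

lemma i_central:
  assumes "a \<in> carrier A" "e \<in> carrier E0"
  shows "i a \<otimes>\<^bsub>E0\<^esub> e = e \<otimes>\<^bsub>E0\<^esub> i a"
proof -
  obtain a0 where a0: "a0 \<in> carrier A0" "a = \<alpha> a0" using assms(1) by (rule A_cases)
  obtain b where b: "b \<in> carrier B0" "e = cls b" using assms(2) by (rule E0_cases)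
  show ?thesis using a0 b central[of a0 b] by (simp add: i_alpha flip: cls.hom_mult)
qed

lemma pi_surj: "\<pi> ` carrier E0 = carrier G0"
  using p0_surj by (auto simp: cls_surj[symmetric] image_image)

text \<open>Injectivity of \<open>\<gamma>\<close> puts the quotient of two elements over the same
  point of \<open>G\<close> into the kernel of \<open>\<pi>\<close>, which is the image of
  \<open>A\<close>. All elements of \<open>A\<close> constructed below from two lifts arise in this
  way.\<close>

lemma gamma_pi_eqE:
  assumes "e \<in> carrier E0" "f \<in> carrier E0" "\<gamma> (\<pi> e) = \<gamma> (\<pi> f)"
  obtains a where "a \<in> carrier A" "e = f \<otimes>\<^bsub>E0\<^esub> i a"
proof -
  have "\<pi> e = \<pi> f" using assms gamma_inj by (auto dest: inj_onD)
  then have "\<pi> (inv\<^bsub>E0\<^esub> f \<otimes>\<^bsub>E0\<^esub> e) = \<one>\<^bsub>G0\<^esub>" using assms by simp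
  then obtain a where "a \<in> carrier A" "inv\<^bsub>E0\<^esub> f \<otimes>\<^bsub>E0\<^esub> e = i a"
    using assms by (meson E0.inv_closed E0.m_closed pi_eq_oneE)
  then have "f \<otimes>\<^bsub>E0\<^esub> (inv\<^bsub>E0\<^esub> f \<otimes>\<^bsub>E0\<^esub> e) = f \<otimes>\<^bsub>E0\<^esub> i a" by simp
  with assms \<open>a \<in> carrier A\<close> that show ?thesis
    by (simp add: E0.m_assoc[symmetric])
qed

end

section \<open>The obstruction as a failing factor set\<close>

context pre_prolongation
begin

section \<open>The crossed module action and the module structure on \<open>A\<close>\<close>

lemma theta_auto: "u \<in> carrier G \<Longrightarrow> \<theta> u \<in> auto E0"
  using crossed by (auto simp: crossed_module_def AutoGroup_def hom_def)

lemma theta_hom: "u \<in> carrier G \<Longrightarrow> \<theta> u \<in> hom E0 E0"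
  using theta_auto by (auto simp: auto_def)

lemma theta_closed [simp]: "u \<in> carrier G \<Longrightarrow> e \<in> carrier E0 \<Longrightarrow> \<theta> u e \<in> carrier E0"
  using theta_hom by (auto simp: hom_def)

lemma theta_mult [simp]: "u \<in> carrier G \<Longrightarrow> e \<in> carrier E0 \<Longrightarrow> f \<in> carrier E0 \<Longrightarrow>
    \<theta> u (e \<otimes>\<^bsub>E0\<^esub> f) = \<theta> u e \<otimes>\<^bsub>E0\<^esub> \<theta> u f"
  using theta_hom by (auto simp: hom_def)

text \<open>Multiplication in \<open>AutoGroup\<close> is composition restricted to the carrier, so
  the law is extracted pointwise on \<open>E0\<close>.\<close>

lemma theta_comp:
  assumes "u \<in> carrier G" "v \<in> carrier G" "e \<in> carrier E0"
  shows "\<theta> (u \<otimes>\<^bsub>G\<^esub> v) e = \<theta> u (\<theta> v e)"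
proof -
  have "\<theta> (u \<otimes>\<^bsub>G\<^esub> v) = \<theta> u \<otimes>\<^bsub>AutoGroup E0\<^esub> \<theta> v"
    using crossed assms by (auto simp: crossed_module_def hom_def)
  then show ?thesis
    using assms theta_auto by (simp add: AutoGroup_def BijGroup_def auto_def compose_def)
qed

lemma theta_gamma_pi:
  "e \<in> carrier E0 \<Longrightarrow> f \<in> carrier E0 \<Longrightarrow> \<theta> (\<gamma> (\<pi> e)) f = conj_by E0 e f"
  using crossed by (auto simp: crossed_module_def)

lemma theta_one: "e \<in> carrier E0 \<Longrightarrow> \<theta> \<one>\<^bsub>G\<^esub> e = e"
  using theta_gamma_pi[of "\<one>\<^bsub>E0\<^esub>" e] by (simp add: conj_by_def)

lemma gamma_pi_theta:
  "u \<in> carrier G \<Longrightarrow> e \<in> carrier E0 \<Longrightarrow>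
    \<gamma> (\<pi> (\<theta> u e)) = u \<otimes>\<^bsub>G\<^esub> \<gamma> (\<pi> e) \<otimes>\<^bsub>G\<^esub> inv\<^bsub>G\<^esub> u"
  using crossed by (auto simp: crossed_module_def conj_by_def)

lemma sigma_eq_oneE:
  assumes "u \<in> carrier G" "\<sigma> u = \<one>\<^bsub>Pi0\<^esub>"
  obtains e where "e \<in> carrier E0" "u = \<gamma> (\<pi> e)"
  using assms pi_surj by (metis imageE sigma_eq_one_iff)

lemma sigma_gamma_pi [simp]: "e \<in> carrier E0 \<Longrightarrow> \<sigma> (\<gamma> (\<pi> e)) = \<one>\<^bsub>Pi0\<^esub>"
  by (simp add: sigma_eq_one_iff)

text \<open>\<open>\<theta> u\<close> preserves the image of \<open>A\<close>, because
  \<open>\<gamma> \<circ> \<pi>\<close> sends the result to a conjugate of the unit. Two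
  representatives of a class differ by some \<open>\<gamma> (\<pi> e)\<close>, which acts as
  conjugation by \<open>e\<close> and so trivially on the central image of \<open>A\<close>.\<close>

lemma act:
  assumes "u \<in> carrier G" "a \<in> carrier A"
  shows "act (\<sigma> u) a \<in> carrier A" "i (act (\<sigma> u) a) = \<theta> u (i a)"
proof -
  \<comment> \<open>The representative that the definition of \<open>act\<close> selects for the
    class of \<open>u\<close>.\<close>
  define v where "v = (SOME v. v \<in> carrier G \<and> \<sigma> v = \<sigma> u)"
  have v: "v \<in> carrier G" "\<sigma> v = \<sigma> u"
    using someI[of "\<lambda>v. v \<in> carrier G \<and> \<sigma> v = \<sigma> u" u] assms by (simp_all add: v_def)
  then have "\<sigma> (v \<otimes>\<^bsub>G\<^esub> inv\<^bsub>G\<^esub> u) = \<one>\<^bsub>Pi0\<^esub>"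
    using assms by simp
  with v assms obtain e where e: "e \<in> carrier E0" "v \<otimes>\<^bsub>G\<^esub> inv\<^bsub>G\<^esub> u = \<gamma> (\<pi> e)"
    by (metis G.inv_closed G.m_closed sigma_eq_oneE)
  then have "v = \<gamma> (\<pi> e) \<otimes>\<^bsub>G\<^esub> u"
    using v assms by (metis G.inv_solve_right' \<gamma>.hom_closed \<pi>.hom_closed)
  moreover have "\<gamma> (\<pi> (\<theta> u (i a))) = \<gamma> (\<pi> \<one>\<^bsub>E0\<^esub>)"
    using assms by (simp add: gamma_pi_theta)
  then obtain b where b: "b \<in> carrier A" "\<theta> u (i a) = \<one>\<^bsub>E0\<^esub> \<otimes>\<^bsub>E0\<^esub> i b"
    using gamma_pi_eqE[of "\<theta> u (i a)" "\<one>\<^bsub>E0\<^esub>"] assms by auto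
  ultimately have "\<theta> v (i a) = i b"
    using e assms i_central[of b e, symmetric]
    by (simp add: theta_comp theta_gamma_pi conj_by_def E0.m_assoc)
  then have "act (\<sigma> u) a = b"
    using b i_inj by (simp add: act_def flip: v_def)
  with b show "act (\<sigma> u) a \<in> carrier A" "i (act (\<sigma> u) a) = \<theta> u (i a)" by simp_all
qed

lemma act_hom:
  assumes "x \<in> carrier Pi0"
  shows "act x \<in> hom A A"
proof -
  obtain u where u: "u \<in> carrier G" "x = \<sigma> u" using assms sigma_surj by blast
  show ?thesis
    unfolding u(2)
    by (rule homI) (auto simp: act u intro!: inj_onD[OF i_inj])
qed

lemma comm_group_A: "comm_group A"
  by (rule A.group_comm_groupI) (rule A_comm)

section \<open>Representatives and lifts of their defect\<close>

definition representatives :: "('g set \<Rightarrow> 'g) \<Rightarrow> bool" where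
  "representatives u \<longleftrightarrow> (\<forall>x\<in>carrier Pi0. u x \<in> carrier G \<and> \<sigma> (u x) = x) \<and> u \<one>\<^bsub>Pi0\<^esub> = \<one>\<^bsub>G\<^esub>"

text \<open>The lifting condition of \<open>choice\<close> without normalisation, since changing a
  lift by an arbitrary cochain can destroy the latter.\<close>

definition factor_lift :: "('g set \<Rightarrow> 'g) \<Rightarrow> ('g set \<Rightarrow> 'g set \<Rightarrow> 'b0 set) \<Rightarrow> bool" where
  "factor_lift u h \<longleftrightarrow> (\<forall>x\<in>carrier Pi0. \<forall>y\<in>carrier Pi0. h x y \<in> carrier E0 \<and>
     \<gamma> (\<pi> (h x y)) = u x \<otimes>\<^bsub>G\<^esub> u y \<otimes>\<^bsub>G\<^esub> inv\<^bsub>G\<^esub> u (x \<otimes>\<^bsub>Pi0\<^esub> y))"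

definition factor_cocycle :: "('g set \<Rightarrow> 'g) \<Rightarrow> ('g set \<Rightarrow> 'g set \<Rightarrow> 'b0 set) \<Rightarrow> bool" where
  "factor_cocycle u h \<longleftrightarrow> (\<forall>x\<in>carrier Pi0. \<forall>y\<in>carrier Pi0. \<forall>z\<in>carrier Pi0.
     \<theta> (u x) (h y z) \<otimes>\<^bsub>E0\<^esub> h x (y \<otimes>\<^bsub>Pi0\<^esub> z) = h x y \<otimes>\<^bsub>E0\<^esub> h (x \<otimes>\<^bsub>Pi0\<^esub> y) z)"

lemma choice_iff:
  "choice u h \<longleftrightarrow> representatives u \<and> factor_lift u h \<and>
     (\<forall>x\<in>carrier Pi0. h x \<one>\<^bsub>Pi0\<^esub> = \<one>\<^bsub>E0\<^esub> \<and> h \<one>\<^bsub>Pi0\<^esub> x = \<one>\<^bsub>E0\<^esub>)"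
  by (auto simp: choice_def representatives_def factor_lift_def)

lemma representativesD:
  assumes "representatives u"
  shows "x \<in> carrier Pi0 \<Longrightarrow> u x \<in> carrier G" "x \<in> carrier Pi0 \<Longrightarrow> \<sigma> (u x) = x"
    "u \<one>\<^bsub>Pi0\<^esub> = \<one>\<^bsub>G\<^esub>"
  using assms by (auto simp: representatives_def)

lemma factor_liftD:
  assumes "factor_lift u h" "x \<in> carrier Pi0" "y \<in> carrier Pi0"
  shows "h x y \<in> carrier E0"
    "\<gamma> (\<pi> (h x y)) = u x \<otimes>\<^bsub>G\<^esub> u y \<otimes>\<^bsub>G\<^esub> inv\<^bsub>G\<^esub> u (x \<otimes>\<^bsub>Pi0\<^esub> y)"
  using assms by (auto simp: factor_lift_def)

lemma ex_choice: "\<exists>u h. choice u h"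
proof -
  define u where "u x = (if x = \<one>\<^bsub>Pi0\<^esub> then \<one>\<^bsub>G\<^esub> else inv_into (carrier G) \<sigma> x)" for x
  have u: "representatives u"
    using sigma_surj by (auto simp: representatives_def u_def inv_into_into f_inv_into_f)
  note uD = representativesD[OF u]
  have "\<exists>e. e \<in> carrier E0 \<and> \<gamma> (\<pi> e) = u x \<otimes>\<^bsub>G\<^esub> u y \<otimes>\<^bsub>G\<^esub> inv\<^bsub>G\<^esub> u (x \<otimes>\<^bsub>Pi0\<^esub> y)"
    if "x \<in> carrier Pi0" "y \<in> carrier Pi0" for x y
    by (rule sigma_eq_oneE[of "u x \<otimes>\<^bsub>G\<^esub> u y \<otimes>\<^bsub>G\<^esub> inv\<^bsub>G\<^esub> u (x \<otimes>\<^bsub>Pi0\<^esub> y)"])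
      (use that in \<open>auto simp: uD\<close>)
  then obtain h where h: "h x y \<in> carrier E0 \<and>
      \<gamma> (\<pi> (h x y)) = u x \<otimes>\<^bsub>G\<^esub> u y \<otimes>\<^bsub>G\<^esub> inv\<^bsub>G\<^esub> u (x \<otimes>\<^bsub>Pi0\<^esub> y)"
    if "x \<in> carrier Pi0" "y \<in> carrier Pi0" for x y
    by metis
  \<comment> \<open>If \<open>x\<close> or \<open>y\<close> is the unit,
    \<open>u \<one> = \<one>\<close> makes the defect trivial, so overwriting the value by the unit
    still gives a lift.\<close>
  define h' where "h' x y = (if x = \<one>\<^bsub>Pi0\<^esub> \<or> y = \<one>\<^bsub>Pi0\<^esub> then \<one>\<^bsub>E0\<^esub> else h x y)" for x y
  have "choice u h'"
    using u h by (auto simp: choice_iff factor_lift_def h'_def uD)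
  then show ?thesis by blast
qed

text \<open>\<open>u x u y\<close> equals \<open>\<gamma> (\<pi> (h x y))\<close> times
  \<open>u (x y)\<close>, and the first factor acts by conjugation. This supplies
  \<open>phi_phi\<close> for the factor system on \<open>E0\<close>.\<close>

lemma theta_theta:
  assumes "representatives u" "factor_lift u h"
    and "x \<in> carrier Pi0" "y \<in> carrier Pi0" "e \<in> carrier E0"
  shows "\<theta> (u x) (\<theta> (u y) e) = conj_by E0 (h x y) (\<theta> (u (x \<otimes>\<^bsub>Pi0\<^esub> y)) e)"
proof -
  note h = factor_liftD[OF assms(2)] and u = representativesD[OF assms(1)]
  have "u x \<otimes>\<^bsub>G\<^esub> u y = \<gamma> (\<pi> (h x y)) \<otimes>\<^bsub>G\<^esub> u (x \<otimes>\<^bsub>Pi0\<^esub> y)"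
    using assms by (simp add: h u G.m_assoc)
  moreover have "\<theta> (\<gamma> (\<pi> (h x y)) \<otimes>\<^bsub>G\<^esub> u (x \<otimes>\<^bsub>Pi0\<^esub> y)) e
    = conj_by E0 (h x y) (\<theta> (u (x \<otimes>\<^bsub>Pi0\<^esub> y)) e)"
    using assms by (subst theta_comp) (simp_all add: theta_gamma_pi h(1) u del: h(2))
  ultimately show ?thesis
    using assms by (simp add: u flip: theta_comp)
qed

text \<open>Both sides of the defining equation without \<open>k\<close> lie over
  \<open>u x u y u z\<close> times the inverse of \<open>u (x y z)\<close>, so they differ by an
  element of \<open>A\<close>, unique because \<open>i\<close> is injective.\<close>

lemma obstruction_cocycle:
  assumes "representatives u" "factor_lift u h"
    and xyz: "x \<in> carrier Pi0" "y \<in> carrier Pi0" "z \<in> carrier Pi0"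
  shows "obstruction_cocycle u h x y z \<in> carrier A"
    and "k \<in> carrier A \<Longrightarrow> obstruction_cocycle u h x y z = k \<longleftrightarrow>
      \<theta> (u x) (h y z) \<otimes>\<^bsub>E0\<^esub> h x (y \<otimes>\<^bsub>Pi0\<^esub> z) = h x y \<otimes>\<^bsub>E0\<^esub> h (x \<otimes>\<^bsub>Pi0\<^esub> y) z \<otimes>\<^bsub>E0\<^esub> i k"
proof -
  note h = factor_liftD[OF assms(2)] and u = representativesD[OF assms(1)]
  let ?L = "\<theta> (u x) (h y z) \<otimes>\<^bsub>E0\<^esub> h x (y \<otimes>\<^bsub>Pi0\<^esub> z)"
  let ?R = "h x y \<otimes>\<^bsub>E0\<^esub> h (x \<otimes>\<^bsub>Pi0\<^esub> y) z"
  have c: "?L \<in> carrier E0" "?R \<in> carrier E0" using xyz by (simp_all add: h u)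
  have "\<gamma> (\<pi> ?L) = \<gamma> (\<pi> ?R)"
    using xyz by (simp add: h u gamma_pi_theta G.m_assoc Pi0.m_assoc)
  with c obtain a where a: "a \<in> carrier A" "?L = ?R \<otimes>\<^bsub>E0\<^esub> i a"
    by (rule gamma_pi_eqE)
  have uniq: "k = a" if "k \<in> carrier A" "?L = ?R \<otimes>\<^bsub>E0\<^esub> i k" for k
  proof -
    have "?R \<otimes>\<^bsub>E0\<^esub> i k = ?R \<otimes>\<^bsub>E0\<^esub> i a" using that(2) a(2) by argo
    then have "i k = i a" using c that a by (simp only: E0.l_cancel i.hom_closed)
    then show ?thesis using that a i_inj by (simp add: inj_on_eq_iff)
  qed
  have eq: "obstruction_cocycle u h x y z = a"
    unfolding obstruction_cocycle_def
  proof (rule the_equality)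
    show "a \<in> carrier A \<and> ?L = ?R \<otimes>\<^bsub>E0\<^esub> i a" using a by (rule conjI)
  qed (elim conjE, rule uniq)
  show "obstruction_cocycle u h x y z \<in> carrier A"
    using a(1) by (simp only: eq)
  show "obstruction_cocycle u h x y z = k \<longleftrightarrow> ?L = ?R \<otimes>\<^bsub>E0\<^esub> i k" if k: "k \<in> carrier A"
    unfolding eq by (metis uniq[OF k] a(2))
qed

text \<open>Centrality collects the contributions of \<open>A\<close> on the right.\<close>

lemma i_shift:
  assumes "e \<in> carrier E0" "f \<in> carrier E0" "a \<in> carrier A" "b \<in> carrier A"
  shows "(e \<otimes>\<^bsub>E0\<^esub> i a) \<otimes>\<^bsub>E0\<^esub> (f \<otimes>\<^bsub>E0\<^esub> i b) = e \<otimes>\<^bsub>E0\<^esub> f \<otimes>\<^bsub>E0\<^esub> i (a \<otimes>\<^bsub>A\<^esub> b)"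
proof -
  have "i a \<otimes>\<^bsub>E0\<^esub> (f \<otimes>\<^bsub>E0\<^esub> i b) = f \<otimes>\<^bsub>E0\<^esub> (i a \<otimes>\<^bsub>E0\<^esub> i b)"
    using assms i_central[of a f] by (simp flip: E0.m_assoc)
  with assms show ?thesis by (simp add: E0.m_assoc)
qed

text \<open>Replacing \<open>g\<close> by \<open>h\<close> multiplies the left side of the factor
  set identity by \<open>i s\<close> and the right side by \<open>i t\<close>, where the coboundary
  of \<open>c\<close> is \<open>s - t\<close> additively. If \<open>k = s - t\<close>, then
  \<open>i s\<close> remains on both sides and cancels, leaving the identity for
  \<open>g\<close>.\<close>

lemma obstruction_cocycle_eq_coboundary_iff:
  assumes "representatives u" "factor_lift u h"
    and c: "c \<in> carrier (cochains Pi0 A 2)"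
    and xyz: "x \<in> carrier Pi0" "y \<in> carrier Pi0" "z \<in> carrier Pi0"
    and g: "\<And>x y. x \<in> carrier Pi0 \<Longrightarrow> y \<in> carrier Pi0 \<Longrightarrow> h x y = g x y \<otimes>\<^bsub>E0\<^esub> i (c [x, y])"
    and gc: "\<And>x y. x \<in> carrier Pi0 \<Longrightarrow> y \<in> carrier Pi0 \<Longrightarrow> g x y \<in> carrier E0"
  shows "obstruction_cocycle u h x y z = coboundary Pi0 A act 2 c [x, y, z] \<longleftrightarrow>
    \<theta> (u x) (g y z) \<otimes>\<^bsub>E0\<^esub> g x (y \<otimes>\<^bsub>Pi0\<^esub> z) = g x y \<otimes>\<^bsub>E0\<^esub> g (x \<otimes>\<^bsub>Pi0\<^esub> y) z"
proof -
  interpret A: comm_group A by (rule comm_group_A)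
  note h = factor_liftD[OF assms(2)] and u = representativesD[OF assms(1)]
  have val: "c [v, w] \<in> carrier A" if "v \<in> carrier Pi0" "w \<in> carrier Pi0" for v w
    using that c by (auto simp: carrier_cochains tuples_def)
  define s t where "s = act x (c [y, z]) \<otimes>\<^bsub>A\<^esub> c [x, y \<otimes>\<^bsub>Pi0\<^esub> z]"
    and "t = c [x, y] \<otimes>\<^bsub>A\<^esub> c [x \<otimes>\<^bsub>Pi0\<^esub> y, z]"
  have actc: "act x (c [y, z]) \<in> carrier A" "i (act x (c [y, z])) = \<theta> (u x) (i (c [y, z]))"
    using act[of "u x" "c [y, z]"] xyz by (simp_all add: u val)
  have st: "s \<in> carrier A" "t \<in> carrier A"
    using xyz actc by (simp_all add: s_def t_def val)
  have d: "coboundary Pi0 A act 2 c [x, y, z] = s \<otimes>\<^bsub>A\<^esub> inv\<^bsub>A\<^esub> t"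
    using coboundary_2[OF Pi0.group_axioms comm_group_A act_hom c xyz] by (simp add: s_def t_def)
  let ?L = "\<theta> (u x) (g y z) \<otimes>\<^bsub>E0\<^esub> g x (y \<otimes>\<^bsub>Pi0\<^esub> z)"
  let ?R = "g x y \<otimes>\<^bsub>E0\<^esub> g (x \<otimes>\<^bsub>Pi0\<^esub> y) z"
  have c: "?L \<in> carrier E0" "?R \<in> carrier E0" using xyz by (simp_all add: gc u)
  have "\<theta> (u x) (h y z) = \<theta> (u x) (g y z) \<otimes>\<^bsub>E0\<^esub> i (act x (c [y, z]))"
    using xyz by (simp add: g gc u val actc)
  then have L: "\<theta> (u x) (h y z) \<otimes>\<^bsub>E0\<^esub> h x (y \<otimes>\<^bsub>Pi0\<^esub> z) = ?L \<otimes>\<^bsub>E0\<^esub> i s"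
    using xyz actc(1) g[of x "y \<otimes>\<^bsub>Pi0\<^esub> z"]
    by (simp add: s_def i_shift gc u val del: i.hom_mult)
  have R: "h x y \<otimes>\<^bsub>E0\<^esub> h (x \<otimes>\<^bsub>Pi0\<^esub> y) z = ?R \<otimes>\<^bsub>E0\<^esub> i t"
    using xyz by (simp add: g t_def i_shift gc val del: i.hom_mult)
  have "?R \<otimes>\<^bsub>E0\<^esub> i t \<otimes>\<^bsub>E0\<^esub> i (s \<otimes>\<^bsub>A\<^esub> inv\<^bsub>A\<^esub> t) = ?R \<otimes>\<^bsub>E0\<^esub> i (t \<otimes>\<^bsub>A\<^esub> (s \<otimes>\<^bsub>A\<^esub> inv\<^bsub>A\<^esub> t))"
    using c st by (simp add: E0.m_assoc)
  also have "t \<otimes>\<^bsub>A\<^esub> (s \<otimes>\<^bsub>A\<^esub> inv\<^bsub>A\<^esub> t) = s"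
    using st A.m_comm[of t "s \<otimes>\<^bsub>A\<^esub> inv\<^bsub>A\<^esub> t"] by (simp add: A.m_assoc)
  finally have "?R \<otimes>\<^bsub>E0\<^esub> i t \<otimes>\<^bsub>E0\<^esub> i (s \<otimes>\<^bsub>A\<^esub> inv\<^bsub>A\<^esub> t) = ?R \<otimes>\<^bsub>E0\<^esub> i s" .
  then show ?thesis
    unfolding d
    using obstruction_cocycle(2)[OF assms(1,2) xyz, of "s \<otimes>\<^bsub>A\<^esub> inv\<^bsub>A\<^esub> t"] st c
    by (simp add: L R del: i.hom_mult)
qed

text \<open>With \<open>h\<close> fixed, cochains \<open>c\<close> and lifts \<open>g\<close> are
  exchanged by the relation \<open>h = g + c\<close>: a given \<open>c\<close> is subtracted from
  \<open>h\<close>, while a given \<open>g\<close> differs from \<open>h\<close> by values in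
  \<open>A\<close>. The pointwise criterion then applies in both directions.\<close>

lemma obstruction_class_eq_one_iff:
  assumes "choice u h"
  shows "obstruction_class u h = \<one>\<^bsub>H3\<^esub> \<longleftrightarrow> (\<exists>g. factor_lift u g \<and> factor_cocycle u g)"
proof -
  have ul: "representatives u" "factor_lift u h" using assms by (auto simp: choice_iff)
  note h = factor_liftD[OF ul(2)] and u = representativesD[OF ul(1)]
  let ?k = "\<lambda>xs\<in>tuples Pi0 3. obstruction_cocycle u h (xs ! 0) (xs ! 1) (xs ! 2)"
  have tuples3: "xs \<in> tuples Pi0 3 \<longleftrightarrow> (\<exists>x\<in>carrier Pi0. \<exists>y\<in>carrier Pi0. \<exists>z\<in>carrier Pi0. xs = [x, y, z])" for xs
    by (auto simp: tuples_def numeral_3_eq_3 length_Suc_conv)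
  have k: "?k \<in> carrier (cochains Pi0 A 3)"
    by (auto simp: carrier_cochains tuples3 obstruction_cocycle(1)[OF ul])
  \<comment> \<open>Both functions have the default value off the triples, so comparison on triples
    suffices.\<close>
  have coc: "?k = coboundary Pi0 A act 2 c \<longleftrightarrow>
      (\<forall>x\<in>carrier Pi0. \<forall>y\<in>carrier Pi0. \<forall>z\<in>carrier Pi0.
        obstruction_cocycle u h x y z = coboundary Pi0 A act 2 c [x, y, z])" for c
  proof
    assume eq: "?k = coboundary Pi0 A act 2 c"
    show "\<forall>x\<in>carrier Pi0. \<forall>y\<in>carrier Pi0. \<forall>z\<in>carrier Pi0.
        obstruction_cocycle u h x y z = coboundary Pi0 A act 2 c [x, y, z]"
    proof (intro ballI)
      fix x y z assume "x \<in> carrier Pi0" "y \<in> carrier Pi0" "z \<in> carrier Pi0"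
      then show "obstruction_cocycle u h x y z = coboundary Pi0 A act 2 c [x, y, z]"
        using fun_cong[OF eq, of "[x, y, z]"] by (simp add: tuples_def)
    qed
  next
    assume *: "\<forall>x\<in>carrier Pi0. \<forall>y\<in>carrier Pi0. \<forall>z\<in>carrier Pi0.
        obstruction_cocycle u h x y z = coboundary Pi0 A act 2 c [x, y, z]"
    show "?k = coboundary Pi0 A act 2 c"
    proof
      fix xs
      show "?k xs = coboundary Pi0 A act 2 c xs"
      proof (cases "xs \<in> tuples Pi0 3")
        case True
        with * show ?thesis by (auto simp: tuples3)
      next
        case False
        then show ?thesis by (simp add: coboundary_def numeral_3_eq_3)
      qed
    qed
  qed
  have "obstruction_class u h = \<one>\<^bsub>H3\<^esub> \<longleftrightarrow> (\<exists>c\<in>carrier (cochains Pi0 A 2). ?k = coboundary Pi0 A act 2 c)"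
    using cohomology_class_eq_one_iff[where n = 2, OF Pi0.group_axioms comm_group_A act_hom] k
    by (auto simp: obstruction_class_def)
  also have "\<dots> \<longleftrightarrow> (\<exists>g. factor_lift u g \<and> factor_cocycle u g)"
  proof safe
    fix c assume c: "c \<in> carrier (cochains Pi0 A 2)" and eq: "?k = coboundary Pi0 A act 2 c"
    have val: "c [x, y] \<in> carrier A" if "x \<in> carrier Pi0" "y \<in> carrier Pi0" for x y
      using that c by (auto simp: carrier_cochains tuples_def)
    define g where "g x y = h x y \<otimes>\<^bsub>E0\<^esub> inv\<^bsub>E0\<^esub> i (c [x, y])" for x y
    have gc: "g x y \<in> carrier E0" "h x y = g x y \<otimes>\<^bsub>E0\<^esub> i (c [x, y])"
      if "x \<in> carrier Pi0" "y \<in> carrier Pi0" for x y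
      using that by (simp_all add: g_def h(1) val E0.m_assoc)
    have "factor_lift u g"
      using ul(2) by (simp add: factor_lift_def g_def val)
    moreover have "factor_cocycle u g"
      using obstruction_cocycle_eq_coboundary_iff[OF ul c _ _ _ gc(2,1)] coc[THEN iffD1, OF eq]
      by (simp add: factor_cocycle_def)
    ultimately show "\<exists>g. factor_lift u g \<and> factor_cocycle u g" by blast
  next
    fix g assume g: "factor_lift u g" "factor_cocycle u g"
    have "\<exists>a. a \<in> carrier A \<and> h x y = g x y \<otimes>\<^bsub>E0\<^esub> i a" if "x \<in> carrier Pi0" "y \<in> carrier Pi0" for x y
      by (rule gamma_pi_eqE[of "h x y" "g x y"]) (use that in \<open>auto simp: h factor_liftD[OF g(1)]\<close>)
    then obtain a where a: "a x y \<in> carrier A" "h x y = g x y \<otimes>\<^bsub>E0\<^esub> i (a x y)"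
      if "x \<in> carrier Pi0" "y \<in> carrier Pi0" for x y
      by metis
    define c where "c = (\<lambda>xs\<in>tuples Pi0 2. a (xs ! 0) (xs ! 1))"
    have c: "c \<in> carrier (cochains Pi0 A 2)"
      by (auto simp: c_def carrier_cochains tuples_def intro!: a(1))
    have cxy: "h x y = g x y \<otimes>\<^bsub>E0\<^esub> i (c [x, y])" if "x \<in> carrier Pi0" "y \<in> carrier Pi0" for x y
      using that a(2) by (simp add: c_def tuples_def)
    have "?k = coboundary Pi0 A act 2 c"
      using obstruction_cocycle_eq_coboundary_iff[OF ul c _ _ _ cxy factor_liftD(1)[OF g(1)]] g(2)
      by (subst coc) (simp add: factor_cocycle_def)
    with c show "\<exists>c\<in>carrier (cochains Pi0 A 2). ?k = coboundary Pi0 A act 2 c" by blast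
  qed
  finally show ?thesis .
qed

section \<open>Factor sets and prolongations\<close>

text \<open>The factor set identity is associativity in \<open>B\<close> for lifts of the
  \<open>u x\<close>, pulled back along the injection of \<open>E0\<close> into
  \<open>B\<close>.\<close>

lemma prolongation_imp_factor_cocycle:
  assumes u: "representatives u"
    and prol: "prolongation B j p \<beta>" and ind: "induces_action B p \<beta>"
  shows "\<exists>g. factor_lift u g \<and> factor_cocycle u g"
proof -
  have se: "short_exact A j B p G" and b: "\<beta> \<in> hom B0 B"
    and bj: "\<And>a. a \<in> carrier A0 \<Longrightarrow> \<beta> (j0 a) = j (\<alpha> a)"
    and pb: "\<And>b. b \<in> carrier B0 \<Longrightarrow> p (\<beta> b) = \<gamma> (p0 b)"
    using prol by (auto simp: prolongation_def)
  interpret B: group B using se by (simp add: short_exact_def)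
  interpret \<beta>: group_hom B0 B \<beta> using b by unfold_locales
  interpret j: group_hom A B j using se by unfold_locales (simp add: short_exact_def mon_def)
  interpret p: group_hom B G p using se by unfold_locales (simp add: short_exact_def epi_def)
  have p_surj: "p ` carrier B = carrier G" and j_inj: "inj_on j (carrier A)"
    and j_image: "j ` carrier A = kernel B G p"
    using se by (auto simp: short_exact_def epi_def mon_def)
  define \<iota> where "\<iota> = induced \<beta>"
  have \<iota>_cls: "\<iota> (cls b) = \<beta> b" if "b \<in> carrier B0" for b
    unfolding \<iota>_def induced_def
    by (rule the_elem_image_cls[OF \<beta>.group_hom_axioms _ that]) (simp add: kernel_def bj)
  interpret \<iota>: group_hom E0 B \<iota>
  proof (unfold_locales, rule homI)
    show "\<iota> e \<in> carrier B" if "e \<in> carrier E0" for e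
      using that by (elim E0_cases) (simp add: \<iota>_cls)
    show "\<iota> (e \<otimes>\<^bsub>E0\<^esub> f) = \<iota> e \<otimes>\<^bsub>B\<^esub> \<iota> f" if "e \<in> carrier E0" "f \<in> carrier E0" for e f
      using that by (elim E0_cases) (simp add: \<iota>_cls flip: cls.hom_mult)
  qed
  have p_\<iota>: "p (\<iota> e) = \<gamma> (\<pi> e)" if "e \<in> carrier E0" for e
    using that by (elim E0_cases) (simp add: \<iota>_cls pb)
  have \<iota>_i: "\<iota> (i a) = j a" if "a \<in> carrier A" for a
    using that by (elim A_cases) (simp add: i_alpha \<iota>_cls bj)
  \<comment> \<open>An element killed by \<open>\<iota>\<close> lies over the unit of
    \<open>G\<close>, hence comes from \<open>A\<close>, where \<open>\<iota>\<close> restricts to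
    the injective \<open>j\<close>.\<close>
  have \<iota>_inj: "inj_on \<iota> (carrier E0)"
  proof (rule \<iota>.inj_on_one_iff[THEN iffD2], intro allI impI)
    fix e assume e: "e \<in> carrier E0" "\<iota> e = \<one>\<^bsub>B\<^esub>"
    then have "\<gamma> (\<pi> e) = \<gamma> (\<pi> \<one>\<^bsub>E0\<^esub>)" using p_\<iota>[of e] by simp
    then obtain a where a: "a \<in> carrier A" "e = \<one>\<^bsub>E0\<^esub> \<otimes>\<^bsub>E0\<^esub> i a"
      using e by (elim gamma_pi_eqE[rotated 2]) auto
    then have "j a = j \<one>\<^bsub>A\<^esub>" using e \<iota>_i[of a] by simp
    then have "a = \<one>\<^bsub>A\<^esub>" using inj_onD[OF j_inj] a(1) by blast
    then show "e = \<one>\<^bsub>E0\<^esub>" using a by simp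
  qed
  \<comment> \<open>Some \<open>e\<close> has the same image in \<open>G\<close> as
    \<open>b\<close>; the remaining quotient lies in the kernel of \<open>p\<close>, that is in
    \<open>j A = \<iota> (i A)\<close>.\<close>
  have \<iota>_image: "\<exists>e. e \<in> carrier E0 \<and> \<iota> e = b" if b: "b \<in> carrier B" "\<sigma> (p b) = \<one>\<^bsub>Pi0\<^esub>" for b
  proof -
    obtain e where e: "e \<in> carrier E0" "p b = \<gamma> (\<pi> e)"
      using b by (elim sigma_eq_oneE[rotated]) simp_all
    then have "b \<otimes>\<^bsub>B\<^esub> inv\<^bsub>B\<^esub> \<iota> e \<in> kernel B G p"
      using b by (simp add: kernel_def p_\<iota>)
    then obtain a where a: "a \<in> carrier A" "b \<otimes>\<^bsub>B\<^esub> inv\<^bsub>B\<^esub> \<iota> e = j a"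
      unfolding j_image[symmetric] by auto
    then have "b = j a \<otimes>\<^bsub>B\<^esub> \<iota> e"
      using b e by (simp add: B.m_assoc flip: a(2))
    with a e show ?thesis by (intro exI[of _ "i a \<otimes>\<^bsub>E0\<^esub> e"]) (simp add: \<iota>_i)
  qed
  note uD = representativesD[OF u]
  have "\<forall>x\<in>carrier Pi0. \<exists>b. b \<in> carrier B \<and> p b = u x"
    using p_surj uD(1) by (metis imageE)
  \<comment> \<open>Nothing is prescribed for \<open>s\<close> at the unit, so the \<open>g\<close>
    obtained from it need not be normalised.\<close>
  then obtain s where s: "s x \<in> carrier B" "p (s x) = u x" if "x \<in> carrier Pi0" for x
    by metis
  have "\<exists>e. e \<in> carrier E0 \<and> \<iota> e = s x \<otimes>\<^bsub>B\<^esub> s y \<otimes>\<^bsub>B\<^esub> inv\<^bsub>B\<^esub> s (x \<otimes>\<^bsub>Pi0\<^esub> y)"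
    if "x \<in> carrier Pi0" "y \<in> carrier Pi0" for x y
    using that by (intro \<iota>_image) (auto simp: s uD)
  then obtain g where g: "g x y \<in> carrier E0"
      "\<iota> (g x y) = s x \<otimes>\<^bsub>B\<^esub> s y \<otimes>\<^bsub>B\<^esub> inv\<^bsub>B\<^esub> s (x \<otimes>\<^bsub>Pi0\<^esub> y)"
    if "x \<in> carrier Pi0" "y \<in> carrier Pi0" for x y
    by metis
  have "factor_lift u g"
    using p_\<iota>[symmetric] by (simp add: factor_lift_def g s)
  moreover have "factor_cocycle u g"
    unfolding factor_cocycle_def
  proof (intro ballI inj_onD[OF \<iota>_inj])
    fix x y z assume xyz: "x \<in> carrier Pi0" "y \<in> carrier Pi0" "z \<in> carrier Pi0"
    \<comment> \<open>The compatibility of \<open>\<theta>\<close> with conjugation enters here;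
      afterwards both sides equal \<open>s x s y s z\<close> times the inverse of
      \<open>s (x y z)\<close>.\<close>
    have "\<iota> (\<theta> (u x) (g y z)) = conj_by B (s x) (\<iota> (g y z))"
      using ind xyz s(1)[of x] g(1)[of y z] unfolding induces_action_def \<iota>_def[symmetric]
      by (simp flip: s(2))
    with xyz show "\<iota> (\<theta> (u x) (g y z) \<otimes>\<^bsub>E0\<^esub> g x (y \<otimes>\<^bsub>Pi0\<^esub> z))
      = \<iota> (g x y \<otimes>\<^bsub>E0\<^esub> g (x \<otimes>\<^bsub>Pi0\<^esub> y) z)"
      by (simp add: g s uD conj_by_def B.m_assoc Pi0.m_assoc)
  qed (simp_all add: g uD)
  ultimately show ?thesis by blast
qed

text \<open>The middle group is the crossed product of \<open>E0\<close> and \<open>Pi0\<close>;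
  \<open>A\<close> and \<open>B0\<close> map to it through \<open>E0\<close>. The two crossed module
  identities make \<open>p\<close> a homomorphism and identify the conjugation action with
  \<open>\<theta>\<close>.\<close>

lemma factor_cocycle_imp_prolongation:
  assumes u: "representatives u" and g: "factor_lift u g" "factor_cocycle u g"
  shows "\<exists>(B :: ('b0 set \<times> 'g set) monoid) j p \<beta>. prolongation B j p \<beta> \<and> induces_action B p \<beta>"
proof -
  note uD = representativesD[OF u] and gD = factor_liftD[OF g(1)]
  interpret X: factor_system E0 Pi0 "\<lambda>x. \<theta> (u x)" g
    using g(2) by unfold_locales
      (auto simp: theta_hom theta_one theta_theta[OF u g(1)] uD gD(1) factor_cocycle_def)
  let ?X = X.extension
  interpret XX: group ?X by (rule X.group_extension)
  interpret emb: group_hom E0 ?X X.kernel_emb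
    using X.kernel_emb_hom by unfold_locales
  define p where "p = (\<lambda>(e, x). \<gamma> (\<pi> e) \<otimes>\<^bsub>G\<^esub> u x)"
  \<comment> \<open>The correction \<open>inv n\<close> is invisible to \<open>p\<close>, since
    \<open>g \<one> \<one>\<close> lies over the unit of \<open>G\<close>.\<close>
  have p_emb: "p (X.kernel_emb e) = \<gamma> (\<pi> e)" if "e \<in> carrier E0" for e
    using that by (simp add: p_def X.kernel_emb_def uD gD)
  have p_hom: "p \<in> hom ?X G"
    by (rule homI) (auto simp: X.carrier_extension X.mult_extension p_def uD gD gamma_pi_theta G.m_assoc)
  \<comment> \<open>The class of \<open>p (e, x)\<close> recovers \<open>x\<close>, which forces the
    second coordinate of a kernel element to be the unit.\<close>
  have \<sigma>_p: "\<sigma> (p (e, x)) = x" if "e \<in> carrier E0" "x \<in> carrier Pi0" for e x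
    using that by (simp add: p_def uD)
  have p_surj: "carrier G \<subseteq> p ` carrier ?X"
  proof
    fix v assume v: "v \<in> carrier G"
    then have "\<sigma> (v \<otimes>\<^bsub>G\<^esub> inv\<^bsub>G\<^esub> u (\<sigma> v)) = \<one>\<^bsub>Pi0\<^esub>" by (simp add: uD)
    then obtain e where e: "e \<in> carrier E0" "v \<otimes>\<^bsub>G\<^esub> inv\<^bsub>G\<^esub> u (\<sigma> v) = \<gamma> (\<pi> e)"
      using v by (elim sigma_eq_oneE[rotated]) (simp_all add: uD)
    then have "v = p (e, \<sigma> v)"
      using v by (simp add: p_def uD G.m_assoc flip: e(2))
    then show "v \<in> p ` carrier ?X"
      by (rule image_eqI) (use e(1) v in \<open>simp add: X.carrier_extension\<close>)
  qed
  have "kernel ?X G p = (X.kernel_emb \<circ> i) ` carrier A"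
  proof (intro equalityI subsetI)
    fix b assume "b \<in> kernel ?X G p"
    then obtain e x where b: "b = (e, x)" "e \<in> carrier E0" "x \<in> carrier Pi0" "p (e, x) = \<one>\<^bsub>G\<^esub>"
      by (auto simp: kernel_def X.carrier_extension)
    with \<sigma>_p[of e x] have x: "x = \<one>\<^bsub>Pi0\<^esub>" by simp
    \<comment> \<open>Multiplying by \<open>n\<close> undoes the correction in
      \<open>kernel_emb\<close>.\<close>
    let ?e = "e \<otimes>\<^bsub>E0\<^esub> X.n"
    have e: "?e \<in> carrier E0" "b = X.kernel_emb ?e"
      using b x by (simp_all add: X.kernel_emb_def E0.m_assoc)
    then have "\<gamma> (\<pi> ?e) = \<gamma> (\<pi> \<one>\<^bsub>E0\<^esub>)"
      using b(4) p_emb[of ?e] unfolding b(1)[symmetric] by simp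
    then obtain a where "a \<in> carrier A" "?e = \<one>\<^bsub>E0\<^esub> \<otimes>\<^bsub>E0\<^esub> i a"
      using e(1) by (elim gamma_pi_eqE[rotated 2]) auto
    with e show "b \<in> (X.kernel_emb \<circ> i) ` carrier A" by auto
  qed (auto simp: kernel_def p_emb)
  moreover have "X.kernel_emb \<circ> i \<in> mon A ?X"
    using i_hom i_inj X.kernel_emb_hom X.kernel_emb_inj
    by (intro mon_compose[of i A E0]) (simp_all add: mon_def)
  ultimately have "short_exact A (X.kernel_emb \<circ> i) ?X p G"
    using p_hom p_surj by (auto simp: short_exact_def epi_def hom_def)
  moreover have "X.kernel_emb \<circ> cls \<in> hom B0 ?X"
    using cls.homh X.kernel_emb_hom by (rule hom_compose)
  ultimately have "prolongation ?X (X.kernel_emb \<circ> i) p (X.kernel_emb \<circ> cls)"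
    by (simp add: prolongation_def i_alpha p_emb)
  moreover have "induces_action ?X p (X.kernel_emb \<circ> cls)"
  proof -
    have ind: "induced (X.kernel_emb \<circ> cls) e = X.kernel_emb e" if e: "e \<in> carrier E0" for e
    proof -
      obtain b where b: "b \<in> carrier B0" "e = cls b" using e by (rule E0_cases)
      have "group_hom B0 ?X (X.kernel_emb \<circ> cls)"
        using \<open>X.kernel_emb \<circ> cls \<in> hom B0 ?X\<close> by unfold_locales
      then have "induced (X.kernel_emb \<circ> cls) (cls b) = (X.kernel_emb \<circ> cls) b"
        unfolding induced_def
        by (rule the_elem_image_cls) (auto simp: b kernel_def simp flip: i_alpha)
      with b show ?thesis by simp
    qed
    \<comment> \<open>This is the automorphism by which \<open>(e, x)\<close> conjugates the
      embedded \<open>E0\<close>, according to \<open>conj_kernel_emb\<close>.\<close>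
    have "\<theta> (p (e, x)) f = conj_by E0 e (\<theta> (u x) f)"
      if "e \<in> carrier E0" "x \<in> carrier Pi0" "f \<in> carrier E0" for e x f
      using that by (simp add: p_def theta_comp theta_gamma_pi uD)
    moreover have "p (e, x) \<in> carrier G" if "e \<in> carrier E0" "x \<in> carrier Pi0" for e x
      using that by (simp add: p_def uD)
    moreover have "conj_by E0 e f \<in> carrier E0" if "e \<in> carrier E0" "f \<in> carrier E0" for e f
      using that by (simp add: conj_by_def)
    ultimately show ?thesis
      by (auto simp: induces_action_def X.carrier_extension ind X.conj_kernel_emb uD)
  qed
  ultimately show ?thesis by blast
qed

text \<open>The criterion holds for every choice of \<open>u\<close> and \<open>h\<close>, in
  particular for the one selected by \<open>SOME\<close> in \<open>Obs\<close>. The constructed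
  group consists of pairs of cosets; \<open>prolongation_transfer\<close> moves it to the type in
  the statement.\<close>

lemma Obs_eq_one_iff:
  "Obs = \<one>\<^bsub>H3\<^esub> \<longleftrightarrow> (\<exists>(B :: ('a \<times> 'g) monoid) j p \<beta>. prolongation B j p \<beta> \<and> induces_action B p \<beta>)"
proof -
  obtain u h where uh: "(SOME (u, h). choice u h) = (u, h)" by (meson surj_pair)
  have "choice u h"
    using someI_ex[of "\<lambda>(u, h). choice u h"] ex_choice uh by auto
  moreover from this have u: "representatives u" by (simp add: choice_iff)
  moreover have "Obs = obstruction_class u h" by (simp add: Obs_def uh)
  ultimately have "Obs = \<one>\<^bsub>H3\<^esub> \<longleftrightarrow> (\<exists>g. factor_lift u g \<and> factor_cocycle u g)"
    using obstruction_class_eq_one_iff by simp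
  then show ?thesis
    using prolongation_imp_factor_cocycle[OF u] factor_cocycle_imp_prolongation[OF u]
      prolongation_transfer
    by metis
qed

end

theorem theorem3p5:
  fixes A0 :: "'a0 monoid" and j0 :: "'a0 \<Rightarrow> 'b0" and B0 :: "'b0 monoid"
    and p0 :: "'b0 \<Rightarrow> 'g0" and G0 :: "'g0 monoid"
    and A :: "'a monoid" and \<alpha> :: "'a0 \<Rightarrow> 'a" and G :: "'g monoid" and \<gamma> :: "'g0 \<Rightarrow> 'g"
    and \<theta> :: "'g \<Rightarrow> 'b0 set \<Rightarrow> 'b0 set"
  assumes "pre_prolongation A0 j0 B0 p0 G0 A \<alpha> G \<gamma> \<theta>"
  shows "(\<exists>(B :: ('a \<times> 'g) monoid) j p \<beta>.
            prolongation_data.prolongation A0 j0 B0 p0 A \<alpha> G \<gamma> B j p \<beta> \<and>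
            pre_prolongation.induces_action A0 j0 B0 A \<alpha> \<theta> B p \<beta>)
         \<longleftrightarrow> pre_prolongation.Obs A0 j0 B0 p0 G0 A \<alpha> G \<gamma> \<theta>
             = \<one>\<^bsub>pre_prolongation.H3 A0 j0 B0 G0 A \<alpha> G \<gamma> \<theta>\<^esub>"
  by (rule pre_prolongation.Obs_eq_one_iff[OF assms, symmetric])

end
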